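(* Let $\Gamma$ be a finitely generated group acting isometrically on a metric space $X$. Suppose that $X$ has the metric sparsification property with a constant $0<c\le1$, and that there exist $0<c'\le1$ and $x_0\in X$ such that, for each $k>0$, the $k$-stabilizer $W_k(x_0)$ has the operator norm localization property with constant $c'$. Then $\Gamma$, as a metric space with a word metric, has the operator norm localization property with constant $\sqrt{c}\,c'$.
   Context: For $k\ge0$ the $k$-stabilizer of $x_0\in X$ is $W_k(x_0)=\{g\in\Gamma: gx_0\in B(x_0,k)\}$, where $B(x_0,k)$ is the closed ball of center $x_0$ and radius $k$; it is regarded as a metric subspace of $\Gamma$ with a word metric (associated to a finite generating set). Metric Sparsification Property: a metric space $X$ has the metric sparsification property with constant $c$, $0<c\le 1$, if there is a non-decreasing function $f:\mathbf{N}\to\mathbf{N}$ such that for all $m\in\mathbf{N}$ and every finite positive Borel measure $\mu$ on $X$ there is a Borel subset $\Omega=\bigsqcup_{i\in I}\Omega_i$ of $X$ with (i) $d(\Omega_i,\Omega_j)\ge m$ for all $i\ne j$; (ii) $\mathrm{Diam}(\Omega_i)\le f(m)$ for all $i$; (iii) $\mu(\Omega)\ge c\,\mu(X)$. Operator norm localization: let $H$ be a separable infinite-dimensional Hilbert space. A Borel measure on a metric space is locally finite if bounded Borel sets have finite measure; positive measures $\nu$ are understood to be nonzero. For a positive locally finite Borel measure $\nu$ on a metric space $Y$, a bounded operator $T$ on $L^2(Y,\nu)\otimes H$ has propagation at most $r$ if $\langle T\varphi,\psi\rangle=0$ whenever $d(\mathrm{Supp}(\varphi),\mathrm{Supp}(\psi))>r$;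 $\mathcal{A}_r(Y,\nu)$ is the set of such operators. $Y$ has the operator norm localization property with constant $c$ ($0<c\le1$) if there is a non-decreasing $f:\mathbf{N}\to\mathbf{N}$ such that for every positive locally finite Borel measure $\nu$ on $Y$, every $k\in\mathbf{N}$ and every $T\in\mathcal{A}_k(Y,\nu)$ there is a nonzero $\varphi\in L^2(Y,\nu)\otimes H$ with $\mathrm{Diam}(\mathrm{Supp}(\varphi))\le f(k)$ and $\|T\varphi\|\ge c\|T\|\|\varphi\|$. *)

theory Defs
  imports "HOL-Analysis.Analysis" "HOL-Algebra.Group_Action" "HOL-Algebra.Generated_Groups"
begin

subsection \<open>Complex Hilbert spaces\<close>

class complex_hilbert = banach +
  fixes scaleC :: "complex \<Rightarrow> 'a \<Rightarrow> 'a"  (infixr \<open>*\<^sub>C\<close> 75)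
    and cinner :: "'a \<Rightarrow> 'a \<Rightarrow> complex"
  assumes scaleR_scaleC: "r *\<^sub>R x = complex_of_real r *\<^sub>C x"
    and scaleC_add_right: "a *\<^sub>C (x + y) = a *\<^sub>C x + a *\<^sub>C y"
    and scaleC_add_left: "(a + b) *\<^sub>C x = a *\<^sub>C x + b *\<^sub>C x"
    and scaleC_scaleC: "a *\<^sub>C (b *\<^sub>C x) = (a * b) *\<^sub>C x"
    and cinner_commute: "cinner x y = cnj (cinner y x)"
    and cinner_add_left: "cinner (x + y) z = cinner x z + cinner y z"
    and cinner_scaleC_left: "cinner (a *\<^sub>C x) y = a * cinner x y"
    and cinner_self: "cinner x x = complex_of_real ((norm x)\<^sup>2)"

text \<open>
  Separability of the Hilbert space is expressed by the sort \<open>second_countable_topology\<close>, which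
  for metric spaces is the same thing; it is what the Bochner integral of the library requires.
\<close>

definition infinite_dimensional :: "'h::complex_hilbert itself \<Rightarrow> bool" where
  "infinite_dimensional _ \<longleftrightarrow>
     (\<forall>B :: 'h set. finite B \<longrightarrow> (\<exists>x. \<forall>a. x \<noteq> (\<Sum>b\<in>B. a b *\<^sub>C b)))"


subsection \<open>The Hilbert space \<open>L\<^sup>2(Y,\<nu>) \<otimes> H\<close>\<close>

text \<open>
  \<open>L\<^sup>2(Y,\<nu>) \<otimes> H\<close> is taken in its usual form \<open>L\<^sup>2(Y,\<nu>;H)\<close>, the square integrable \<open>H\<close>-valued
  functions. Its elements are handled through representatives, so equality of elements is equality
  almost everywhere, and an operator is a map on representatives that respects it.
\<close>

definition L2 :: "'a measure \<Rightarrow> ('a \<Rightarrow> 'h::{complex_hilbert,second_countable_topology}) set" where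
  "L2 \<nu> = {\<phi> \<in> borel_measurable \<nu>. integrable \<nu> (\<lambda>y. (norm (\<phi> y))\<^sup>2)}"

definition L2_inner ::
  "'a measure \<Rightarrow> ('a \<Rightarrow> 'h::{complex_hilbert,second_countable_topology}) \<Rightarrow> ('a \<Rightarrow> 'h) \<Rightarrow> complex" where
  "L2_inner \<nu> \<phi> \<psi> = (LINT y|\<nu>. cinner (\<phi> y) (\<psi> y))"

definition L2_norm ::
  "'a measure \<Rightarrow> ('a \<Rightarrow> 'h::{complex_hilbert,second_countable_topology}) \<Rightarrow> real" where
  "L2_norm \<nu> \<phi> = sqrt (LINT y|\<nu>. (norm (\<phi> y))\<^sup>2)"

definition L2_bounded_operator ::
  "'a measure \<Rightarrow>
   (('a \<Rightarrow> 'h::{complex_hilbert,second_countable_topology}) \<Rightarrow> ('a \<Rightarrow> 'h)) \<Rightarrow> bool" where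
  "L2_bounded_operator \<nu> T \<longleftrightarrow>
     (\<forall>\<phi>\<in>L2 \<nu>. T \<phi> \<in> L2 \<nu>) \<and>
     (\<forall>\<phi>\<in>L2 \<nu>. \<forall>\<psi>\<in>L2 \<nu>. (AE y in \<nu>. \<phi> y = \<psi> y) \<longrightarrow> (AE y in \<nu>. T \<phi> y = T \<psi> y)) \<and>
     (\<forall>\<phi>\<in>L2 \<nu>. \<forall>\<psi>\<in>L2 \<nu>. AE y in \<nu>. T (\<lambda>z. \<phi> z + \<psi> z) y = T \<phi> y + T \<psi> y) \<and>
     (\<forall>a. \<forall>\<phi>\<in>L2 \<nu>. AE y in \<nu>. T (\<lambda>z. a *\<^sub>C \<phi> z) y = a *\<^sub>C T \<phi> y) \<and>
     (\<exists>C. \<forall>\<phi>\<in>L2 \<nu>. L2_norm \<nu> (T \<phi>) \<le> C * L2_norm \<nu> \<phi>)"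

definition L2_opnorm ::
  "'a measure \<Rightarrow>
   (('a \<Rightarrow> 'h::{complex_hilbert,second_countable_topology}) \<Rightarrow> ('a \<Rightarrow> 'h)) \<Rightarrow> real" where
  "L2_opnorm \<nu> T = (SUP \<phi>\<in>{\<phi> \<in> L2 \<nu>. L2_norm \<nu> \<phi> \<le> 1}. L2_norm \<nu> (T \<phi>))"


subsection \<open>Metric sparsification and operator norm localization\<close>

context Metric_space
begin

definition mdiam :: "'a set \<Rightarrow> ennreal" where
  "mdiam A = (SUP x\<in>A. SUP y\<in>A. ennreal (d x y))"

definition msetdist :: "'a set \<Rightarrow> 'a set \<Rightarrow> ennreal" where
  "msetdist A B = (INF x\<in>A. INF y\<in>B. ennreal (d x y))"

text \<open>Positive measures are nonzero.\<close>

definition positive_borel_measure :: "'a measure \<Rightarrow> bool" where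
  "positive_borel_measure \<mu> \<longleftrightarrow>
     space \<mu> = M \<and> sets \<mu> = sigma_sets M {U. openin mtopology U} \<and> emeasure \<mu> M \<noteq> 0"

definition locally_finite :: "'a measure \<Rightarrow> bool" where
  "locally_finite \<mu> \<longleftrightarrow> (\<forall>A\<in>sets \<mu>. mbounded A \<longrightarrow> emeasure \<mu> A < \<infinity>)"

text \<open>
  The pieces \<open>\<Omega>\<^sub>i\<close> are given as a set \<open>P\<close> of subsets rather than as an indexed family; disjointness
  is stated separately because the distance condition does not give it for \<open>m = 0\<close>.
\<close>

definition metric_sparsification :: "real \<Rightarrow> bool" where
  "metric_sparsification c \<longleftrightarrow> 0 < c \<and> c \<le> 1 \<and>
     (\<exists>f :: nat \<Rightarrow> nat. mono f \<and>
       (\<forall>m \<mu>. positive_borel_measure \<mu> \<and> finite_measure \<mu> \<longrightarrow>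
         (\<exists>P :: 'a set set. \<Union>P \<in> sets \<mu> \<and> disjoint P \<and>
            (\<forall>A\<in>P. \<forall>B\<in>P. A \<noteq> B \<longrightarrow> msetdist A B \<ge> of_nat m) \<and>
            (\<forall>A\<in>P. mdiam A \<le> of_nat (f m)) \<and>
            measure \<mu> (\<Union>P) \<ge> c * measure \<mu> M)))"

text \<open>The complement in \<open>M\<close> of the union of all open sets on which \<open>\<phi>\<close> vanishes almost everywhere.\<close>

definition L2_supp ::
  "'a measure \<Rightarrow> ('a \<Rightarrow> 'h::{complex_hilbert,second_countable_topology}) \<Rightarrow> 'a set" where
  "L2_supp \<nu> \<phi> = M - \<Union>{U. openin mtopology U \<and> (AE y in \<nu>. y \<in> U \<longrightarrow> \<phi> y = 0)}"

definition propagation_operators ::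
  "real \<Rightarrow> 'a measure \<Rightarrow>
   (('a \<Rightarrow> 'h::{complex_hilbert,second_countable_topology}) \<Rightarrow> ('a \<Rightarrow> 'h)) set" where
  "propagation_operators r \<nu> = {T. L2_bounded_operator \<nu> T \<and>
     (\<forall>\<phi>\<in>L2 \<nu>. \<forall>\<psi>\<in>L2 \<nu>. msetdist (L2_supp \<nu> \<phi>) (L2_supp \<nu> \<psi>) > ennreal r \<longrightarrow>
        L2_inner \<nu> (T \<phi>) \<psi> = 0)}"

definition operator_norm_localization ::
  "'h::{complex_hilbert,second_countable_topology} itself \<Rightarrow> real \<Rightarrow> bool" where
  "operator_norm_localization _ c \<longleftrightarrow> 0 < c \<and> c \<le> 1 \<and>
     (\<exists>f :: nat \<Rightarrow> nat. mono f \<and>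
       (\<forall>\<nu> k. \<forall>T :: ('a \<Rightarrow> 'h) \<Rightarrow> ('a \<Rightarrow> 'h).
          positive_borel_measure \<nu> \<and> locally_finite \<nu> \<and>
          T \<in> propagation_operators (real k) \<nu> \<longrightarrow>
          (\<exists>\<phi>\<in>L2 \<nu>. \<not> (AE y in \<nu>. \<phi> y = 0) \<and>
             mdiam (L2_supp \<nu> \<phi>) \<le> of_nat (f k) \<and>
             L2_norm \<nu> (T \<phi>) \<ge> c * L2_opnorm \<nu> T * L2_norm \<nu> \<phi>)))"

end


subsection \<open>Word metrics and stabilizers\<close>

definition word_length :: "('g, 'b) monoid_scheme \<Rightarrow> 'g set \<Rightarrow> 'g \<Rightarrow> nat" where
  "word_length G S g = (LEAST n. \<exists>w. length w = n \<and> set w \<subseteq> S \<union> (\<lambda>s. inv\<^bsub>G\<^esub> s) ` S \<and>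
     g = foldr (\<otimes>\<^bsub>G\<^esub>) w \<one>\<^bsub>G\<^esub>)"

text \<open>The value 0 off the carrier only serves the totality requirements of \<open>Metric_space\<close>.\<close>

definition word_metric :: "('g, 'b) monoid_scheme \<Rightarrow> 'g set \<Rightarrow> 'g \<Rightarrow> 'g \<Rightarrow> real" where
  "word_metric G S g h =
     (if g \<in> carrier G \<and> h \<in> carrier G then real (word_length G S (inv\<^bsub>G\<^esub> g \<otimes>\<^bsub>G\<^esub> h)) else 0)"

definition k_stabilizer ::
  "('g, 'b) monoid_scheme \<Rightarrow> 'x set \<Rightarrow> ('x \<Rightarrow> 'x \<Rightarrow> real) \<Rightarrow> ('g \<Rightarrow> 'x \<Rightarrow> 'x) \<Rightarrow> 'x \<Rightarrow> real \<Rightarrow> 'g set"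
  where "k_stabilizer G X d act x0 k = {g \<in> carrier G. act g x0 \<in> Metric_space.mcball X d x0 k}"

context group
begin

abbreviation (input) is_word :: "'a set \<Rightarrow> 'a list \<Rightarrow> 'a \<Rightarrow> bool" where
  "is_word S w g \<equiv> set w \<subseteq> S \<union> (\<lambda>s. inv s) ` S \<and> g = foldr (\<otimes>) w \<one>"

lemma foldr_mult_closed: "set w \<subseteq> carrier G \<Longrightarrow> foldr (\<otimes>) w \<one> \<in> carrier G"
  by (induction w) auto

lemma foldr_mult_append:
  "set v \<subseteq> carrier G \<Longrightarrow> set w \<subseteq> carrier G \<Longrightarrow>
   foldr (\<otimes>) (v @ w) \<one> = foldr (\<otimes>) v \<one> \<otimes> foldr (\<otimes>) w \<one>"
  by (induction v) (auto simp: foldr_mult_closed m_assoc simp del: foldr_append)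

lemma inv_foldr_mult:
  "set w \<subseteq> carrier G \<Longrightarrow> inv (foldr (\<otimes>) w \<one>) = foldr (\<otimes>) (rev (map (\<lambda>s. inv s) w)) \<one>"
proof (induction w)
  case (Cons a w)
  have "set (rev (map (\<lambda>s. inv s) w)) \<subseteq> carrier G" using Cons.prems by auto
  then have "foldr (\<otimes>) (rev (map (\<lambda>s. inv s) w) @ [inv a]) \<one> =
      foldr (\<otimes>) (rev (map (\<lambda>s. inv s) w)) \<one> \<otimes> foldr (\<otimes>) [inv a] \<one>"
    using Cons.prems by (intro foldr_mult_append) auto
  with Cons show ?case by (simp add: foldr_mult_closed inv_mult_group del: foldr_append)
qed simp

lemma letters_in_carrier: "S \<subseteq> carrier G \<Longrightarrow> S \<union> (\<lambda>s. inv s) ` S \<subseteq> carrier G"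
  by auto

lemma ex_word:
  assumes "S \<subseteq> carrier G" "g \<in> generate G S"
  shows "\<exists>w. is_word S w g"
  using assms(2)
proof induction
  case one
  show ?case by (rule exI[of _ "[]"]) simp
next
  case (incl h)
  then show ?case using assms(1) by (intro exI[of _ "[h]"]) auto
next
  case (inv h)
  then show ?case using assms(1) by (intro exI[of _ "[inv h]"]) auto
next
  case (eng h1 h2)
  then obtain v w where vw: "is_word S v h1" "is_word S w h2" by blast
  then have "set v \<subseteq> carrier G" "set w \<subseteq> carrier G"
    using letters_in_carrier[OF assms(1)] by blast+
  from foldr_mult_append[OF this] vw show ?case
    by (intro exI[of _ "v @ w"]) (simp del: foldr_append)
qed

lemma word_length_le: "is_word S w g \<Longrightarrow> word_length G S g \<le> length w"
  unfolding word_length_def by (rule Least_le) blast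

lemma obtain_word:
  assumes "S \<subseteq> carrier G" "generate G S = carrier G" "g \<in> carrier G"
  obtains w where "is_word S w g" "length w = word_length G S g"
proof -
  have "\<exists>n w. length w = n \<and> is_word S w g" using ex_word assms by metis
  then have "\<exists>w. length w = word_length G S g \<and> is_word S w g"
    unfolding word_length_def by (rule LeastI_ex)
  with that show ?thesis by blast
qed

lemma word_length_inv_le:
  assumes "S \<subseteq> carrier G" "generate G S = carrier G" "g \<in> carrier G"
  shows "word_length G S (inv g) \<le> word_length G S g"
proof -
  obtain w where w: "is_word S w g" "length w = word_length G S g"
    using obtain_word assms by blast
  then have sub: "set w \<subseteq> carrier G" using letters_in_carrier[OF assms(1)] by blast
  have "set (rev (map (\<lambda>s. inv s) w)) \<subseteq> S \<union> (\<lambda>s. inv s) ` S"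
    using w(1) assms(1) by force
  then have "word_length G S (inv g) \<le> length (rev (map (\<lambda>s. inv s) w))"
    using inv_foldr_mult[OF sub] w(1) by (intro word_length_le) simp
  then show ?thesis using w(2) by simp
qed

lemma word_length_mult_le:
  assumes "S \<subseteq> carrier G" "generate G S = carrier G" "g \<in> carrier G" "h \<in> carrier G"
  shows "word_length G S (g \<otimes> h) \<le> word_length G S g + word_length G S h"
proof -
  obtain v where v: "is_word S v g" "length v = word_length G S g"
    using obtain_word assms by blast
  obtain w where w: "is_word S w h" "length w = word_length G S h"
    using obtain_word assms by blast
  have "set v \<subseteq> carrier G" "set w \<subseteq> carrier G"
    using v w letters_in_carrier[OF assms(1)] by blast+
  from foldr_mult_append[OF this] have "word_length G S (g \<otimes> h) \<le> length (v @ w)"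
    using v w by (intro word_length_le) (simp del: foldr_append)
  then show ?thesis using v w by simp
qed

lemma word_length_eq_0_iff:
  assumes "S \<subseteq> carrier G" "generate G S = carrier G" "g \<in> carrier G"
  shows "word_length G S g = 0 \<longleftrightarrow> g = \<one>"
proof
  assume "word_length G S g = 0"
  then show "g = \<one>" using obtain_word[OF assms] by (metis foldr_Nil id_apply length_0_conv)
next
  assume "g = \<one>"
  then show "word_length G S g = 0" using word_length_le[of "[]" S g] by simp
qed

lemma Metric_space_word_metric:
  assumes "S \<subseteq> carrier G" "generate G S = carrier G"
  shows "Metric_space (carrier G) (word_metric G S)"
proof
  fix x y z
  show "0 \<le> word_metric G S x y" by (simp add: word_metric_def)
  have sym: "word_length G S (inv x \<otimes> y) \<le> word_length G S (inv y \<otimes> x)"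
    if "x \<in> carrier G" "y \<in> carrier G" for x y
    using word_length_inv_le[OF assms, of "inv y \<otimes> x"] that by (simp add: inv_mult_group)
  show "word_metric G S x y = word_metric G S y x"
    using sym[of x y] sym[of y x] by (auto simp: word_metric_def)
  assume xy: "x \<in> carrier G" "y \<in> carrier G"
  have "inv x \<otimes> y = \<one> \<longleftrightarrow> x = y"
    using xy by (metis inv_closed inv_equality inv_inv l_inv)
  with xy show "word_metric G S x y = 0 \<longleftrightarrow> x = y"
    by (simp add: word_metric_def word_length_eq_0_iff[OF assms])
  assume z: "z \<in> carrier G"
  have "y \<otimes> (inv y \<otimes> z) = z"
    using xy z by (simp add: m_assoc [symmetric])
  then have "inv x \<otimes> z = (inv x \<otimes> y) \<otimes> (inv y \<otimes> z)"
    using xy z by (simp add: m_assoc)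
  then show "word_metric G S x z \<le> word_metric G S x y + word_metric G S y z"
    using word_length_mult_le[OF assms, of "inv x \<otimes> y" "inv y \<otimes> z"] xy z
    by (simp add: word_metric_def)
qed

end

end

theory Submission
  imports Defs
begin

text \<open>
  The orbit map \<open>\<pi> g = g x\<^sub>0\<close> is Lipschitz. Given \<open>T\<close> of propagation \<open>k\<close> and \<open>\<psi>\<close> almost realising
  its norm, sparsify the image under \<open>\<pi>\<close> of the measure \<open>|T\<psi>|\<^sup>2 \<nu>\<close> at a scale larger than
  \<open>2 L (k + 1)\<close>. Cutting \<open>\<psi>\<close> down to the disjoint neighbourhoods of the preimages of the pieces and
  comparing sums of squares, some piece of \<open>\<psi>\<close> is stretched by a factor at least
  \<open>sqrt c \<parallel>T\<parallel>\<close>. It is supported in a left translate of some \<open>W\<^sub>R\<close>, so localization there, applied to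
  the compression of \<open>T\<close>, finishes the argument.

  The norm of \<open>T\<close> need not be attained, which costs a factor \<open>1 - \<epsilon>\<close>. For \<open>c < 1\<close> it is
  recovered by first improving the sparsification constant to \<open>2 c - c\<^sup>2 > c\<close>. For \<open>c = 1\<close> the orbit
  is bounded, so the group itself is one of the \<open>W\<^sub>R\<close>.
\<close>

subsection \<open>Improving the sparsification constant\<close>

context Metric_space
begin

lemma mdiam_le_iff:
  "0 \<le> D \<Longrightarrow> mdiam A \<le> ennreal D \<longleftrightarrow> (\<forall>x\<in>A. \<forall>y\<in>A. d x y \<le> D)"
  by (auto simp: mdiam_def SUP_le_iff)

lemma msetdist_ge_iff:
  "ennreal m \<le> msetdist A B \<longleftrightarrow> (\<forall>x\<in>A. \<forall>y\<in>B. m \<le> d x y)"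
  by (auto simp: msetdist_def le_INF_iff)

text \<open>Pointwise real inequalities stand in for the \<open>ennreal\<close>-valued distances and
  diameters. For \<open>m > 0\<close> and pieces inside \<open>M\<close>, the separation makes
  distinct pieces disjoint.\<close>

definition sparse_family :: "real \<Rightarrow> real \<Rightarrow> 'a set set \<Rightarrow> bool" where
  "sparse_family m D P \<longleftrightarrow>
     (\<forall>A\<in>P. \<forall>B\<in>P. A \<noteq> B \<longrightarrow> (\<forall>a\<in>A. \<forall>b\<in>B. m \<le> d a b)) \<and>
     (\<forall>A\<in>P. \<forall>a\<in>A. \<forall>b\<in>A. d a b \<le> D)"

text \<open>The property at one scale, with real \<open>m\<close> and \<open>D\<close>, so that a
  scale such as \<open>3 * m + 2 * D1\<close> can be inserted directly.\<close>

definition sparsifies :: "real \<Rightarrow> real \<Rightarrow> real \<Rightarrow> bool" where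
  "sparsifies c m D \<longleftrightarrow>
     (\<forall>\<mu>. positive_borel_measure \<mu> \<and> finite_measure \<mu> \<longrightarrow>
        (\<exists>P. \<Union>P \<in> sets \<mu> \<and> sparse_family m D P \<and> c * measure \<mu> M \<le> measure \<mu> (\<Union>P)))"

lemma metric_sparsification_sparsifies:
  assumes "metric_sparsification c"
  obtains D where "0 \<le> D" "sparsifies c m D"
proof -
  obtain f :: "nat \<Rightarrow> nat" where f:
    "\<And>m \<mu>. positive_borel_measure \<mu> \<and> finite_measure \<mu> \<Longrightarrow>
         \<exists>P :: 'a set set. \<Union>P \<in> sets \<mu> \<and> disjoint P \<and>
            (\<forall>A\<in>P. \<forall>B\<in>P. A \<noteq> B \<longrightarrow> msetdist A B \<ge> of_nat m) \<and>
            (\<forall>A\<in>P. mdiam A \<le> of_nat (f m)) \<and>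
            measure \<mu> (\<Union>P) \<ge> c * measure \<mu> M"
    using assms unfolding metric_sparsification_def by metis
  \<comment> \<open>Rounding the scale up to a natural number only strengthens the
    separation.\<close>
  define n where "n = nat \<lceil>m\<rceil>"
  have n: "m \<le> real n" unfolding n_def by linarith
  have "sparsifies c m (real (f n))"
    unfolding sparsifies_def
  proof (intro allI impI)
    fix \<mu> :: "'a measure"
    assume "positive_borel_measure \<mu> \<and> finite_measure \<mu>"
    from f[OF this, of n] obtain P where P: "\<Union>P \<in> sets \<mu>"
      "\<forall>A\<in>P. \<forall>B\<in>P. A \<noteq> B \<longrightarrow> msetdist A B \<ge> of_nat n"
      "\<forall>A\<in>P. mdiam A \<le> of_nat (f n)" "measure \<mu> (\<Union>P) \<ge> c * measure \<mu> M"
      by (elim exE conjE)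
    have "sparse_family m (real (f n)) P"
      unfolding sparse_family_def
    proof (intro conjI ballI impI)
      fix A B a b assume "A \<in> P" "B \<in> P" "A \<noteq> B" "a \<in> A" "b \<in> B"
      then have "real n \<le> d a b"
        using P(2) msetdist_ge_iff[of "real n" A B] by (simp add: ennreal_of_nat_eq_real_of_nat)
      then show "m \<le> d a b" using n by simp
    next
      fix A a b assume "A \<in> P" "a \<in> A" "b \<in> A"
      then show "d a b \<le> real (f n)"
        using P(3) mdiam_le_iff[of "real (f n)" A] by (simp add: ennreal_of_nat_eq_real_of_nat)
    qed
    with P show "\<exists>P. \<Union>P \<in> sets \<mu> \<and> sparse_family m (real (f n)) P \<and>
        c * measure \<mu> M \<le> measure \<mu> (\<Union>P)" by blast
  qed
  then show ?thesis using that[of "real (f n)"] by simp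
qed

text \<open>Each piece of \<open>Q\<close>, cut down to the complement of \<open>\<Union>P\<close>,
  is attached to any piece of \<open>P\<close> that it comes closer than \<open>m\<close> to, and
  stays a piece of its own if there is none. Attached points are within \<open>m + D1\<close> of
  their core, so distinct enlarged cores stay \<open>3 * m + 2 * D1 - 2 * (m + D1) = m\<close>
  apart, and diameters grow by at most \<open>2 * (m + D1)\<close>.\<close>

lemma sparse_family_merge:
  assumes m: "0 < m" and D1: "0 \<le> D1"
    and P: "sparse_family (3 * m + 2 * D1) D2 P" and Q: "sparse_family m D1 Q"
    and sub: "\<Union>P \<subseteq> M" "\<Union>Q \<subseteq> M" and D2: "0 \<le> D2"
  obtains R where "\<Union>R = \<Union>P \<union> \<Union>Q" "sparse_family m (D2 + 2 * (m + D1)) R"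
proof -
  define near where "near A B \<longleftrightarrow> (\<exists>a\<in>A. \<exists>b\<in>B - \<Union>P. d a b < m)" for A B
  define E where "E A = A \<union> \<Union>{B - \<Union>P |B. B \<in> Q \<and> near A B}" for A
  define F where "F = {B - \<Union>P |B. B \<in> Q \<and> (\<forall>A\<in>P. \<not> near A B)}"
  define R where "R = E ` P \<union> F"
  have Qd: "d a b \<le> D1" if "B \<in> Q" "a \<in> B" "b \<in> B" for a b B
    using Q that unfolding sparse_family_def by metis
  have Qs: "m \<le> d a b" if "B \<in> Q" "B' \<in> Q" "B \<noteq> B'" "a \<in> B" "b \<in> B'" for a b B B'
    using Q that unfolding sparse_family_def by metis
  have Pd: "d a b \<le> D2" if "B \<in> P" "a \<in> B" "b \<in> B" for a b B
    using P that unfolding sparse_family_def by metis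
  have Ps: "3 * m + 2 * D1 \<le> d a b" if "B \<in> P" "B' \<in> P" "B \<noteq> B'" "a \<in> B" "b \<in> B'" for a b B B'
    using P that unfolding sparse_family_def by metis
  have EM: "e \<in> M" if "A \<in> P" "e \<in> E A" for A e
    using that sub unfolding E_def by blast
  have Enear: "\<exists>a\<in>A. a \<in> M \<and> d a e \<le> m + D1" if A: "A \<in> P" and e: "e \<in> E A" for A e
  proof (cases "e \<in> A")
    case True
    then show ?thesis using A sub m D1 by (intro bexI[of _ e]) auto
  next
    case False
    then obtain B where B: "B \<in> Q" "near A B" "e \<in> B" using e unfolding E_def by blast
    then obtain a b where ab: "a \<in> A" "b \<in> B" "d a b < m" unfolding near_def by blast
    have "a \<in> M" "b \<in> M" "e \<in> M" using ab A B sub by auto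
    then show ?thesis using triangle[of a b e] Qd[OF B(1) ab(2) B(3)] ab by (intro bexI[of _ a]) auto
  qed
  have EE: "m \<le> d e e'" if AA: "A \<in> P" "A' \<in> P" "A \<noteq> A'" "e \<in> E A" "e' \<in> E A'" for A A' e e'
  proof -
    obtain a where a: "a \<in> A" "a \<in> M" "d a e \<le> m + D1" using Enear AA by blast
    obtain a' where a': "a' \<in> A'" "a' \<in> M" "d a' e' \<le> m + D1" using Enear AA by blast
    have "d a a' \<le> d a e + d e e' + d e' a'"
      using triangle[of a e a'] triangle[of e e' a'] a a' EM[OF AA(1,4)] EM[OF AA(2,5)] by simp
    then show ?thesis using Ps[OF AA(1-3) a(1) a'(1)] a a' commute[of a' e'] by linarith
  qed
  have EF: "m \<le> d e b" if A: "A \<in> P" "e \<in> E A" and B: "B \<in> F" "b \<in> B" for A B e b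
  proof -
    obtain B0 where B0: "B = B0 - \<Union>P" "B0 \<in> Q" "\<forall>A\<in>P. \<not> near A B0"
      using B unfolding F_def by blast
    show ?thesis
    proof (cases "e \<in> A")
      case True
      then have "\<not> d e b < m" using B0 A(1) B unfolding near_def by blast
      then show ?thesis by simp
    next
      case False
      then obtain B' where B': "B' \<in> Q" "near A B'" "e \<in> B'" using A unfolding E_def by blast
      \<comment> \<open>\<open>B'\<close> is near the core \<open>A\<close> and \<open>B0\<close> is
        near no core, so the separation within \<open>Q\<close> applies.\<close>
      then have "B' \<noteq> B0" using B0 A by blast
      then show ?thesis using Qs[OF B'(1) B0(2) _ B'(3)] B B0 by blast
    qed
  qed
  have FF: "m \<le> d a b" if "A \<in> F" "B \<in> F" "A \<noteq> B" "a \<in> A" "b \<in> B" for A B a b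
    using that Qs unfolding F_def by blast
  have "sparse_family m (D2 + 2 * (m + D1)) R"
    unfolding sparse_family_def
  proof (intro conjI ballI impI)
    fix A B a b assume AB: "A \<in> R" "B \<in> R" "A \<noteq> B" "a \<in> A" "b \<in> B"
    have "A \<in> E ` P \<or> A \<in> F" "B \<in> E ` P \<or> B \<in> F"
      using AB unfolding R_def by auto
    then show "m \<le> d a b"
    proof (elim disjE)
      assume "A \<in> E ` P" "B \<in> E ` P"
      then obtain A' B' where "A' \<in> P" "B' \<in> P" "A = E A'" "B = E B'" by blast
      then show ?thesis using AB EE[of A' B' a b] by auto
    next
      assume "A \<in> E ` P" "B \<in> F"
      then show ?thesis using AB EF[of _ a B b] by auto
    next
      assume "A \<in> F" "B \<in> E ` P"
      then show ?thesis using AB EF[of _ b A a] commute[of a b] by auto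
    next
      assume "A \<in> F" "B \<in> F"
      then show ?thesis using AB FF by auto
    qed
  next
    fix A a b assume R: "A \<in> R" "a \<in> A" "b \<in> A"
    show "d a b \<le> D2 + 2 * (m + D1)"
    proof (cases "A \<in> F")
      case True
      then have "d a b \<le> D1" using Qd R unfolding F_def by blast
      then show ?thesis using m D1 D2 by simp
    next
      case False
      then obtain A0 where A0: "A0 \<in> P" "A = E A0" using R unfolding R_def by blast
      obtain x where x: "x \<in> A0" "x \<in> M" "d x a \<le> m + D1" using Enear A0 R by blast
      obtain y where y: "y \<in> A0" "y \<in> M" "d y b \<le> m + D1" using Enear A0 R by blast
      have "a \<in> M" "b \<in> M" using EM A0 R by auto
      then have "d a b \<le> d a x + d x y + d y b"
        using triangle[of a x b] triangle[of x y b] x y by simp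
      then have "d a b \<le> (m + D1) + D2 + (m + D1)"
        using Pd[OF A0(1) x(1) y(1)] x(3) y(3) commute[of a x] by linarith
      then show ?thesis by (simp add: algebra_simps)
    qed
  qed
  moreover have "\<Union>R = \<Union>P \<union> \<Union>Q"
  proof
    show "\<Union>R \<subseteq> \<Union>P \<union> \<Union>Q" unfolding R_def E_def F_def by auto
    have "x \<in> \<Union>R" if "A \<in> P" "x \<in> A" for x A
      using that unfolding R_def E_def by auto
    moreover have "x \<in> \<Union>R" if B: "B \<in> Q" "x \<in> B" and x: "x \<notin> \<Union>P" for x B
    proof (cases "\<exists>A\<in>P. near A B")
      case True
      then obtain A where A: "A \<in> P" "near A B" by blast
      then have "x \<in> E A" using B x unfolding E_def by blast
      then show ?thesis using A unfolding R_def by blast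
    next
      case False
      then have "B - \<Union>P \<in> F" using B unfolding F_def by blast
      then show ?thesis using B x unfolding R_def by blast
    qed
    ultimately show "\<Union>P \<union> \<Union>Q \<subseteq> \<Union>R" by (meson Un_iff UnionE subsetI)
  qed
  ultimately show ?thesis by (intro that)
qed

text \<open>
  Sparsify at a large scale, then sparsify the restriction of the measure to the complement at
  scale \<open>m\<close>; the large scale leaves room to attach each new piece to the old piece it is close to.
\<close>

lemma metric_sparsification_improve:
  assumes ms: "metric_sparsification c" and m: "0 < m"
  obtains D where "0 \<le> D" "sparsifies (2 * c - c\<^sup>2) m D"
proof -
  have c: "0 < c" "c \<le> 1" using ms unfolding metric_sparsification_def by auto
  obtain D1 where D1: "0 \<le> D1" "sparsifies c m D1"
    using metric_sparsification_sparsifies[OF ms] .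
  obtain D2 where D2: "0 \<le> D2" "sparsifies c (3 * m + 2 * D1) D2"
    using metric_sparsification_sparsifies[OF ms] .
  have "sparsifies (2 * c - c\<^sup>2) m (D2 + 2 * (m + D1))"
    unfolding sparsifies_def
  proof (intro allI impI)
    fix \<mu> :: "'a measure"
    assume \<mu>: "positive_borel_measure \<mu> \<and> finite_measure \<mu>"
    then interpret finite_measure \<mu> by blast
    have sp: "space \<mu> = M" using \<mu> unfolding positive_borel_measure_def by blast
    have M: "M \<in> sets \<mu>" using sp by (metis sets.top)
    obtain P where P: "\<Union>P \<in> sets \<mu>" "sparse_family (3 * m + 2 * D1) D2 P"
      "c * measure \<mu> M \<le> measure \<mu> (\<Union>P)"
      using D2(2) \<mu> unfolding sparsifies_def by blast
    define \<rho> where "\<rho> = density \<mu> (indicator (M - \<Union>P))"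
    have em: "emeasure \<rho> A = emeasure \<mu> ((M - \<Union>P) \<inter> A)" if "A \<in> sets \<mu>" for A
      unfolding \<rho>_def using that P M by (subst emeasure_density) (auto simp flip: indicator_inter_arith)
    have meas: "measure \<rho> A = measure \<mu> ((M - \<Union>P) \<inter> A)" if "A \<in> sets \<mu>" for A
      using em[OF that] by (simp add: measure_def)
    obtain Q where Q: "\<Union>Q \<in> sets \<mu>" "sparse_family m D1 Q"
      "c * measure \<mu> (M - \<Union>P) \<le> measure \<mu> (\<Union>Q - \<Union>P)"
    proof (cases "emeasure \<mu> (M - \<Union>P) = 0")
      \<comment> \<open>When the complement is null, the restricted measure is zero and hence not a
        positive measure; the empty family then serves as \<open>Q\<close>.\<close>
      case True
      show ?thesis
        by (rule that[of "{}"]) (auto simp: sparse_family_def measure_def True)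
    next
      case False
      have "positive_borel_measure \<rho>"
        using \<mu> False em[OF M] unfolding positive_borel_measure_def
        by (simp add: \<rho>_def Int_absorb2)
      moreover have "finite_measure \<rho>"
        using em[OF M] sp by (intro finite_measureI) (simp add: \<rho>_def)
      ultimately obtain Q where Q: "\<Union>Q \<in> sets \<rho>" "sparse_family m D1 Q"
        "c * measure \<rho> M \<le> measure \<rho> (\<Union>Q)"
        using D1(2) unfolding sparsifies_def by blast
      then have QM: "\<Union>Q \<in> sets \<mu>" "\<Union>Q \<subseteq> M"
        using sets.sets_into_space[of "\<Union>Q" \<mu>] sp by (auto simp: \<rho>_def)
      have "(M - \<Union>P) \<inter> \<Union>Q = \<Union>Q - \<Union>P" "(M - \<Union>P) \<inter> M = M - \<Union>P" using QM by blast+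
      then show ?thesis using that[OF QM(1) Q(2)] Q(3) meas[OF M] meas[OF QM(1)] by simp
    qed
    have sub: "\<Union>P \<subseteq> M" "\<Union>Q \<subseteq> M"
      using sets.sets_into_space[OF P(1)] sets.sets_into_space[OF Q(1)] sp by auto
    obtain R where R: "\<Union>R = \<Union>P \<union> \<Union>Q" "sparse_family m (D2 + 2 * (m + D1)) R"
      using sparse_family_merge[OF m D1(1) P(2) Q(2) sub D2(1)] .
    have "measure \<mu> (\<Union>R) = measure \<mu> (\<Union>P) + measure \<mu> (\<Union>Q - \<Union>P)"
      unfolding R(1) using P(1) Q(1) by (simp add: finite_measure_Union')
    moreover have "c * measure \<mu> (M - \<Union>P) = c * measure \<mu> M - c * measure \<mu> (\<Union>P)"
      using P(1) M sub by (simp add: finite_measure_Diff algebra_simps)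
    \<comment> \<open>Normalise the total mass to 1 and let \<open>p\<close> be the mass caught by
      \<open>P\<close>. Both stages catch at least \<open>p + c * (1 - p) = (1 - c) * p + c\<close>,
      and \<open>p \<ge> c\<close> makes this at least \<open>(1 - c) * c + c\<close>.\<close>
    moreover have "(1 - c) * (c * measure \<mu> M) \<le> (1 - c) * measure \<mu> (\<Union>P)"
      using P(3) c by (intro mult_left_mono) auto
    ultimately have "(2 * c - c\<^sup>2) * measure \<mu> M \<le> measure \<mu> (\<Union>R)"
      using Q(3) by (simp add: algebra_simps power2_eq_square)
    moreover have "\<Union>R \<in> sets \<mu>" unfolding R(1) using P Q by blast
    ultimately show "\<exists>P. \<Union>P \<in> sets \<mu> \<and> sparse_family m (D2 + 2 * (m + D1)) P \<and>
        (2 * c - c\<^sup>2) * measure \<mu> M \<le> measure \<mu> (\<Union>P)"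
      using R(2) by blast
  qed
  moreover have "0 \<le> D2 + 2 * (m + D1)" using D1 D2 m by simp
  ultimately show ?thesis using that by blast
qed

end


subsection \<open>Operators on \<open>L\<^sup>2\<close>\<close>

lemma measurable_Pow:
  "sets N = Pow (space N) \<Longrightarrow> f \<in> space N \<rightarrow> space K \<Longrightarrow> f \<in> measurable N K"
  by (auto simp: measurable_def)

lemma borel_measurable_Pow:
  fixes f :: "'a \<Rightarrow> 'b::topological_space"
  shows "sets N = Pow (space N) \<Longrightarrow> f \<in> borel_measurable N"
  by (rule measurable_Pow) auto

lemma cinner_zero_right: "cinner x (0::'h::complex_hilbert) = 0"
proof -
  have "cinner (0::'h) x = 0" using cinner_add_left[of "0::'h" 0 x] by simp
  then show ?thesis using cinner_commute[of x 0] by simp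
qed

lemma scaleC_zero_right: "a *\<^sub>C (0::'h::complex_hilbert) = 0"
  using scaleC_add_right[of a "0::'h" 0] by simp

lemma L2_norm_nonneg [simp]: "0 \<le> L2_norm \<nu> \<phi>"
  by (simp add: L2_norm_def)

lemma L2_norm_cong_AE:
  assumes "\<phi> \<in> borel_measurable \<nu>" "\<psi> \<in> borel_measurable \<nu>" "AE y in \<nu>. \<phi> y = \<psi> y"
  shows "L2_norm \<nu> \<phi> = L2_norm \<nu> \<psi>"
proof -
  have "(LINT y|\<nu>. (norm (\<phi> y))\<^sup>2) = (LINT y|\<nu>. (norm (\<psi> y))\<^sup>2)"
    using assms by (intro integral_cong_AE) auto
  then show ?thesis by (simp add: L2_norm_def)
qed

lemma ennreal_L2_norm_square:
  "\<phi> \<in> L2 \<nu> \<Longrightarrow> ennreal ((L2_norm \<nu> \<phi>)\<^sup>2) = (\<integral>\<^sup>+y. ennreal ((norm (\<phi> y))\<^sup>2) \<partial>\<nu>)"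
  by (simp add: L2_def L2_norm_def nn_integral_eq_integral)

lemma L2_norm_eq_0_iff:
  assumes "\<phi> \<in> L2 \<nu>"
  shows "L2_norm \<nu> \<phi> = 0 \<longleftrightarrow> (AE y in \<nu>. \<phi> y = 0)"
  using assms by (simp add: L2_def L2_norm_def integral_nonneg_eq_0_iff_AE)

lemma L2_restrict:
  assumes \<phi>: "\<phi> \<in> L2 \<nu>" and A: "A \<inter> space \<nu> \<in> sets \<nu>"
  shows "(\<lambda>y. if y \<in> A then \<phi> y else 0) \<in> L2 \<nu>"
proof -
  have \<phi>m [measurable]: "\<phi> \<in> borel_measurable \<nu>" using \<phi> by (simp add: L2_def)
  have [measurable]: "(\<lambda>y. if y \<in> A then \<phi> y else 0) \<in> borel_measurable \<nu>"
    using A by (intro measurable_If_set) auto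
  have "integrable \<nu> (\<lambda>y. (norm (if y \<in> A then \<phi> y else 0))\<^sup>2)"
    by (rule Bochner_Integration.integrable_bound[of \<nu> "\<lambda>y. (norm (\<phi> y))\<^sup>2"])
      (use \<phi> in \<open>auto simp: L2_def\<close>)
  then show ?thesis by (simp add: L2_def)
qed

lemma L2_norm_restrict_mono:
  assumes "\<phi> \<in> L2 \<nu>" "A \<inter> space \<nu> \<in> sets \<nu>" "B \<inter> space \<nu> \<in> sets \<nu>" "A \<subseteq> B"
  shows "L2_norm \<nu> (\<lambda>y. if y \<in> A then \<phi> y else 0) \<le> L2_norm \<nu> (\<lambda>y. if y \<in> B then \<phi> y else 0)"
  unfolding L2_norm_def using L2_restrict[OF assms(1,2)] L2_restrict[OF assms(1,3)] assms(4)
  by (intro real_sqrt_le_mono integral_mono) (auto simp: L2_def)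

text \<open>Squared norms of cut-offs become values of a measure, so that sums over disjoint sets
  are handled by countable additivity.\<close>

lemma emeasure_density_L2:
  assumes "\<phi> \<in> L2 \<nu>" "A \<in> sets \<nu>"
  shows "emeasure (density \<nu> (\<lambda>y. ennreal ((norm (\<phi> y))\<^sup>2))) A =
    ennreal ((L2_norm \<nu> (\<lambda>y. if y \<in> A then \<phi> y else 0))\<^sup>2)"
proof -
  have [measurable]: "\<phi> \<in> borel_measurable \<nu>" using assms(1) by (simp add: L2_def)
  have "emeasure (density \<nu> (\<lambda>y. ennreal ((norm (\<phi> y))\<^sup>2))) A =
      (\<integral>\<^sup>+y. ennreal ((norm (\<phi> y))\<^sup>2) * indicator A y \<partial>\<nu>)"
    using assms(2) by (intro emeasure_density) auto
  also have "\<dots> = (\<integral>\<^sup>+y. ennreal ((norm (if y \<in> A then \<phi> y else 0))\<^sup>2) \<partial>\<nu>)"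
    by (intro nn_integral_cong) auto
  finally show ?thesis
    using assms by (simp add: ennreal_L2_norm_square L2_restrict)
qed

lemma L2_scaleR:
  fixes \<phi> :: "'a \<Rightarrow> 'h::{complex_hilbert,second_countable_topology}"
  assumes "\<phi> \<in> L2 \<nu>"
  shows "(\<lambda>y. complex_of_real r *\<^sub>C \<phi> y) \<in> L2 \<nu>"
    and "L2_norm \<nu> (\<lambda>y. complex_of_real r *\<^sub>C \<phi> y) = \<bar>r\<bar> * L2_norm \<nu> \<phi>"
  using assms by (auto simp: L2_def L2_norm_def power_mult_distrib real_sqrt_mult simp flip: scaleR_scaleC)

lemma L2_bounded_operatorD:
  assumes "L2_bounded_operator \<nu> T"
  shows "\<phi> \<in> L2 \<nu> \<Longrightarrow> T \<phi> \<in> L2 \<nu>"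
    and "\<phi> \<in> L2 \<nu> \<Longrightarrow> \<psi> \<in> L2 \<nu> \<Longrightarrow> AE y in \<nu>. \<phi> y = \<psi> y \<Longrightarrow> AE y in \<nu>. T \<phi> y = T \<psi> y"
    and "\<phi> \<in> L2 \<nu> \<Longrightarrow> \<psi> \<in> L2 \<nu> \<Longrightarrow> AE y in \<nu>. T (\<lambda>z. \<phi> z + \<psi> z) y = T \<phi> y + T \<psi> y"
    and "\<phi> \<in> L2 \<nu> \<Longrightarrow> AE y in \<nu>. T (\<lambda>z. a *\<^sub>C \<phi> z) y = a *\<^sub>C T \<phi> y"
    and "\<exists>C. \<forall>\<phi>\<in>L2 \<nu>. L2_norm \<nu> (T \<phi>) \<le> C * L2_norm \<nu> \<phi>"
  using assms unfolding L2_bounded_operator_def by simp_all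

lemma L2_opnorm_bdd_above:
  assumes "L2_bounded_operator \<nu> T"
  shows "bdd_above ((\<lambda>\<phi>. L2_norm \<nu> (T \<phi>)) ` {\<phi> \<in> L2 \<nu>. L2_norm \<nu> \<phi> \<le> 1})"
proof -
  obtain C where C: "\<And>\<phi>. \<phi> \<in> L2 \<nu> \<Longrightarrow> L2_norm \<nu> (T \<phi>) \<le> C * L2_norm \<nu> \<phi>"
    using L2_bounded_operatorD(5)[OF assms] by blast
  have "L2_norm \<nu> (T \<phi>) \<le> \<bar>C\<bar>" if "\<phi> \<in> L2 \<nu>" "L2_norm \<nu> \<phi> \<le> 1" for \<phi>
  proof -
    have "C * L2_norm \<nu> \<phi> \<le> \<bar>C\<bar> * 1" using that by (intro mult_mono) auto
    then show ?thesis using C[OF that(1)] by simp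
  qed
  then show ?thesis by (intro bdd_aboveI[of _ "\<bar>C\<bar>"]) auto
qed

lemma zero_in_L2 [simp]: "(\<lambda>_. 0) \<in> L2 \<nu>" "L2_norm \<nu> (\<lambda>_. 0) = 0"
  by (auto simp: L2_def L2_norm_def)

lemma L2_opnorm_nonneg:
  assumes "L2_bounded_operator \<nu> T"
  shows "0 \<le> L2_opnorm \<nu> T"
proof -
  have "L2_norm \<nu> (T (\<lambda>_. 0)) \<le> L2_opnorm \<nu> T"
    unfolding L2_opnorm_def by (intro cSUP_upper L2_opnorm_bdd_above[OF assms]) simp
  then show ?thesis using L2_norm_nonneg order_trans by blast
qed

lemma L2_norm_le_opnorm:
  fixes \<phi> :: "'a \<Rightarrow> 'h::{complex_hilbert,second_countable_topology}"
  assumes T: "L2_bounded_operator \<nu> T" and \<phi>: "\<phi> \<in> L2 \<nu>"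
  shows "L2_norm \<nu> (T \<phi>) \<le> L2_opnorm \<nu> T * L2_norm \<nu> \<phi>"
proof (cases "L2_norm \<nu> \<phi> = 0")
  \<comment> \<open>A function of norm zero cannot be normalised; boundedness forces its image to
    have norm zero too.\<close>
  case True
  obtain C where "L2_norm \<nu> (T \<phi>) \<le> C * L2_norm \<nu> \<phi>"
    using L2_bounded_operatorD(5)[OF T] \<phi> by blast
  then show ?thesis using True by simp
next
  case False
  define n where "n = L2_norm \<nu> \<phi>"
  have n: "n > 0" using False L2_norm_nonneg[of \<nu> \<phi>] unfolding n_def by linarith
  define \<psi> where "\<psi> = (\<lambda>y. complex_of_real (1 / n) *\<^sub>C \<phi> y)"
  have \<psi>: "\<psi> \<in> L2 \<nu>" "L2_norm \<nu> \<psi> = 1"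
    using L2_scaleR[OF \<phi>, of "1 / n"] n by (auto simp: \<psi>_def n_def)
  have TL: "T \<phi> \<in> L2 \<nu>" "T \<psi> \<in> L2 \<nu>" using L2_bounded_operatorD(1)[OF T] \<phi> \<psi> by auto
  have "AE y in \<nu>. T \<psi> y = complex_of_real (1 / n) *\<^sub>C T \<phi> y"
    unfolding \<psi>_def by (rule L2_bounded_operatorD(4)[OF T \<phi>])
  then have "L2_norm \<nu> (T \<psi>) = L2_norm \<nu> (\<lambda>y. complex_of_real (1 / n) *\<^sub>C T \<phi> y)"
    using TL(2) L2_scaleR(1)[OF TL(1), of "1 / n"] by (intro L2_norm_cong_AE) (auto simp: L2_def)
  also have "\<dots> = L2_norm \<nu> (T \<phi>) / n"
    using L2_scaleR(2)[OF TL(1), of "1 / n"] n by simp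
  finally have "L2_norm \<nu> (T \<phi>) / n = L2_norm \<nu> (T \<psi>)" ..
  also have "\<dots> \<le> L2_opnorm \<nu> T"
    unfolding L2_opnorm_def using \<psi> by (intro cSUP_upper L2_opnorm_bdd_above[OF T]) auto
  finally show ?thesis using n by (simp add: n_def field_simps)
qed

text \<open>Take a function in the unit ball whose image has norm above \<open>s\<close>, as the
  supremum provides; since its norm is at most 1 and \<open>s \<ge> 0\<close>, the homogeneous form
  follows.\<close>

lemma L2_almost_opnorm:
  assumes T: "L2_bounded_operator \<nu> T" and s: "0 \<le> s" "s < L2_opnorm \<nu> T"
  obtains \<psi> where "\<psi> \<in> L2 \<nu>" "s * L2_norm \<nu> \<psi> < L2_norm \<nu> (T \<psi>)"
proof -
  have "\<exists>\<psi>\<in>{\<phi> \<in> L2 \<nu>. L2_norm \<nu> \<phi> \<le> 1}. s < L2_norm \<nu> (T \<psi>)"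
    using s(2) unfolding L2_opnorm_def
    by (subst (asm) less_cSUP_iff[OF _ L2_opnorm_bdd_above[OF T]])
      (auto intro: exI[of _ "\<lambda>_. 0"])
  then obtain \<psi> where \<psi>: "\<psi> \<in> L2 \<nu>" "L2_norm \<nu> \<psi> \<le> 1" "s < L2_norm \<nu> (T \<psi>)" by blast
  have "s * L2_norm \<nu> \<psi> \<le> s" using \<psi> s by (simp add: mult_left_le)
  then show ?thesis using that[OF \<psi>(1)] \<psi>(3) by simp
qed


subsection \<open>Uniformly discrete metric spaces\<close>

text \<open>Models word metrics, which take natural values, and their restrictions to subsets. Open
  balls of radius 1 are singletons, so the topology is discrete: every set is Borel and every
  function is measurable.\<close>

locale uniformly_discrete_metric_space = Metric_space +
  assumes uniformly_discrete: "x \<in> M \<Longrightarrow> y \<in> M \<Longrightarrow> x \<noteq> y \<Longrightarrow> 1 \<le> d x y"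
begin

lemma openin_iff_subset: "openin mtopology U \<longleftrightarrow> U \<subseteq> M"
proof
  assume U: "U \<subseteq> M"
  have "mball x 1 \<subseteq> U" if "x \<in> U" for x
    using uniformly_discrete[of x] that U by (fastforce simp: mball_def)
  then show "openin mtopology U" using U unfolding openin_mtopology
    by (metis zero_less_one)
qed (auto simp: openin_mtopology)

lemma positive_borel_measure_iff:
  "positive_borel_measure \<nu> \<longleftrightarrow> space \<nu> = M \<and> sets \<nu> = Pow M \<and> emeasure \<nu> M \<noteq> 0"
proof -
  have "sigma_sets M {U. openin mtopology U} = Pow M"
    using sigma_sets_top[of M "Pow M"]
    by (auto simp: openin_iff_subset dest: sigma_sets_into_sp[rotated] intro: sigma_sets.Basic)
  then show ?thesis by (simp add: positive_borel_measure_def)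
qed

text \<open>Singletons are open, so a point lies outside the support exactly when
  \<open>\<phi>\<close> vanishes almost everywhere on its singleton.\<close>

lemma L2_supp_eq:
  assumes "space \<nu> = M" "sets \<nu> = Pow M"
  shows "L2_supp \<nu> \<phi> = {y \<in> M. \<phi> y \<noteq> 0 \<and> emeasure \<nu> {y} \<noteq> 0}"
proof -
  have AE: "(AE y in \<nu>. y \<in> U \<longrightarrow> \<phi> y = 0) \<longleftrightarrow> emeasure \<nu> {y \<in> U. \<phi> y \<noteq> 0} = 0"
    if "U \<subseteq> M" for U
  proof -
    have "{x \<in> space \<nu>. \<not> (x \<in> U \<longrightarrow> \<phi> x = 0)} = {y \<in> U. \<phi> y \<noteq> 0}" using that assms by auto
    then show ?thesis
      using that assms by (subst AE_iff_measurable[of "{y \<in> U. \<phi> y \<noteq> 0}"]) auto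
  qed
  have "(\<exists>U. openin mtopology U \<and> (AE y in \<nu>. y \<in> U \<longrightarrow> \<phi> y = 0) \<and> x \<in> U) \<longleftrightarrow>
      \<phi> x = 0 \<or> emeasure \<nu> {x} = 0" if x: "x \<in> M" for x
  proof
    assume "\<exists>U. openin mtopology U \<and> (AE y in \<nu>. y \<in> U \<longrightarrow> \<phi> y = 0) \<and> x \<in> U"
    then obtain U where U: "U \<subseteq> M" "emeasure \<nu> {y \<in> U. \<phi> y \<noteq> 0} = 0" "x \<in> U"
      using AE openin_iff_subset by blast
    show "\<phi> x = 0 \<or> emeasure \<nu> {x} = 0"
    proof (rule disjCI)
      assume "emeasure \<nu> {x} \<noteq> 0"
      show "\<phi> x = 0"
      proof (rule ccontr)
        assume "\<phi> x \<noteq> 0"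
        then have "emeasure \<nu> {x} \<le> emeasure \<nu> {y \<in> U. \<phi> y \<noteq> 0}"
          using U assms by (intro emeasure_mono) auto
        then show False using U(2) \<open>emeasure \<nu> {x} \<noteq> 0\<close> by simp
      qed
    qed
  next
    assume *: "\<phi> x = 0 \<or> emeasure \<nu> {x} = 0"
    have "{y \<in> {x}. \<phi> y \<noteq> 0} = (if \<phi> x = 0 then {} else {x})" by auto
    then have "emeasure \<nu> {y \<in> {x}. \<phi> y \<noteq> 0} = 0" using * by auto
    then show "\<exists>U. openin mtopology U \<and> (AE y in \<nu>. y \<in> U \<longrightarrow> \<phi> y = 0) \<and> x \<in> U"
      using AE[of "{x}"] x openin_iff_subset[of "{x}"] by blast
  qed
  then show ?thesis unfolding L2_supp_def by auto
qed

lemma L2_supp_subset: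
  "space \<nu> = M \<Longrightarrow> sets \<nu> = Pow M \<Longrightarrow> (\<And>y. y \<in> M \<Longrightarrow> y \<notin> A \<Longrightarrow> \<phi> y = 0) \<Longrightarrow> L2_supp \<nu> \<phi> \<subseteq> A"
  by (auto simp: L2_supp_eq)

text \<open>Split \<open>\<psi>\<close> at \<open>N\<close>. The outer part is farther than
  \<open>r\<close> from \<open>A\<close>, so its image under \<open>T\<close> is orthogonal to every
  function supported in \<open>A\<close>. Testing against the restriction of that image to
  \<open>A\<close> shows that the restriction has norm zero.\<close>

lemma propagation_localize:
  fixes T :: "('a \<Rightarrow> 'h::{complex_hilbert,second_countable_topology}) \<Rightarrow> 'a \<Rightarrow> 'h"
  assumes T: "T \<in> propagation_operators r \<nu>" and \<nu>: "space \<nu> = M" "sets \<nu> = Pow M"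
    and \<psi>: "\<psi> \<in> L2 \<nu>" and r: "0 \<le> r" "r < r'"
    and sep: "\<And>a y. a \<in> A \<Longrightarrow> y \<in> M - N \<Longrightarrow> r' \<le> d y a"
  shows "AE y in \<nu>. y \<in> A \<longrightarrow> T (\<lambda>z. if z \<in> N then \<psi> z else 0) y = T \<psi> y"
proof -
  have bT: "L2_bounded_operator \<nu> T" using T by (simp add: propagation_operators_def)
  define \<psi>1 where "\<psi>1 = (\<lambda>z. if z \<in> N then \<psi> z else 0)"
  define \<psi>2 where "\<psi>2 = (\<lambda>z. if z \<in> - N then \<psi> z else 0)"
  have L: "\<psi>1 \<in> L2 \<nu>" "\<psi>2 \<in> L2 \<nu>"
    unfolding \<psi>1_def \<psi>2_def using \<psi> \<nu> by (intro L2_restrict; auto)+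
  have T2: "T \<psi>2 \<in> L2 \<nu>" using L2_bounded_operatorD(1)[OF bT] L by blast
  define \<eta> where "\<eta> = (\<lambda>y. if y \<in> A then T \<psi>2 y else 0)"
  have \<eta>: "\<eta> \<in> L2 \<nu>" unfolding \<eta>_def using T2 \<nu> by (intro L2_restrict) auto
  have "L2_supp \<nu> \<psi>2 \<subseteq> M - N" "L2_supp \<nu> \<eta> \<subseteq> A"
    unfolding \<psi>2_def \<eta>_def using \<nu> by (auto simp: L2_supp_eq split: if_splits)
  then have "ennreal r' \<le> msetdist (L2_supp \<nu> \<psi>2) (L2_supp \<nu> \<eta>)"
    unfolding msetdist_def le_INF_iff using sep by (meson ennreal_leI subsetD)
  \<comment> \<open>An infimum of distances larger than \<open>r\<close> may equal \<open>r\<close>;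
    the uniform bound \<open>r'\<close> keeps the inequality strict.\<close>
  then have "ennreal r < msetdist (L2_supp \<nu> \<psi>2) (L2_supp \<nu> \<eta>)"
    using r by (meson ennreal_lessI less_le_trans le_less_trans)
  then have "L2_inner \<nu> (T \<psi>2) \<eta> = 0"
    using T L(2) \<eta> unfolding propagation_operators_def by simp
  moreover have "cinner (T \<psi>2 y) (\<eta> y) = complex_of_real ((norm (\<eta> y))\<^sup>2)" for y
    unfolding \<eta>_def by (simp add: cinner_self cinner_zero_right)
  ultimately have "(LINT y|\<nu>. (norm (\<eta> y))\<^sup>2) = 0"
    unfolding L2_inner_def by (simp del: of_real_power)
  then have "AE y in \<nu>. \<eta> y = 0"
    using L2_norm_eq_0_iff[OF \<eta>] by (simp add: L2_norm_def)
  moreover have "AE y in \<nu>. T (\<lambda>z. \<psi>1 z + \<psi>2 z) y = T \<psi>1 y + T \<psi>2 y"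
    using L2_bounded_operatorD(3)[OF bT] L by blast
  moreover have "(\<lambda>z. \<psi>1 z + \<psi>2 z) = \<psi>" by (auto simp: \<psi>1_def \<psi>2_def)
  ultimately show ?thesis unfolding \<psi>1_def[symmetric] by (auto simp: \<eta>_def)
qed

text \<open>Otherwise \<open>M\<close> would be a countable union of null singletons. The atom later
  carries a test function for operators of norm zero.\<close>

lemma ex_atom:
  assumes "positive_borel_measure \<nu>" "countable M"
  obtains y where "y \<in> M" "emeasure \<nu> {y} \<noteq> 0"
proof -
  have \<nu>: "space \<nu> = M" "sets \<nu> = Pow M" "emeasure \<nu> M \<noteq> 0"
    using assms positive_borel_measure_iff by auto
  have "\<exists>y\<in>M. emeasure \<nu> {y} \<noteq> 0"
  proof (rule ccontr)
    assume "\<not> (\<exists>y\<in>M. emeasure \<nu> {y} \<noteq> 0)"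
    then have "(\<Union>y\<in>M. {y}) \<in> null_sets \<nu>"
      using \<nu> assms(2) by (intro null_sets_UN') (auto simp: null_sets_def)
    then show False using \<nu>(3) by auto
  qed
  then show ?thesis using that by blast
qed

end

section \<open>Transport of measures and operators along an isometric embedding\<close>

locale isometric_pullback =
  Y: uniformly_discrete_metric_space Y dY + W: uniformly_discrete_metric_space W dW
  for Y :: "'a set" and dY :: "'a \<Rightarrow> 'a \<Rightarrow> real" and W :: "'b set" and dW :: "'b \<Rightarrow> 'b \<Rightarrow> real" +
  fixes \<tau> :: "'b \<Rightarrow> 'a" and \<nu> :: "'a measure"
  assumes \<tau>_in: "w \<in> W \<Longrightarrow> \<tau> w \<in> Y"
    and isometric: "u \<in> W \<Longrightarrow> v \<in> W \<Longrightarrow> dY (\<tau> u) (\<tau> v) = dW u v"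
    and space_\<nu>: "space \<nu> = Y" and sets_\<nu>: "sets \<nu> = Pow Y"
begin

definition \<sigma> :: "'a \<Rightarrow> 'b" where "\<sigma> = inv_into W \<tau>"

text \<open>The point \<open>w\<close> receives the mass of \<open>\<tau> w\<close>. As a
  push-forward of a restriction, the measure turns integrals over \<open>W\<close> into integrals
  over \<open>Y\<close> of functions extended by zero.\<close>

definition pull :: "'b measure" where
  "pull = distr (restrict_space \<nu> (\<tau> ` W)) (count_space W) \<sigma>"

definition extend :: "('b \<Rightarrow> 'h::zero) \<Rightarrow> 'a \<Rightarrow> 'h" where
  "extend \<phi> y = (if y \<in> \<tau> ` W then \<phi> (\<sigma> y) else 0)"

text \<open>On square integrable functions this is the operator \<open>V* T V\<close>, where
  \<open>V\<close> is the isometry \<open>extend\<close> and its adjoint \<open>V*\<close> restricts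
  a function to the image of \<open>\<tau>\<close>.\<close>

definition compress :: "(('a \<Rightarrow> 'h::zero) \<Rightarrow> 'a \<Rightarrow> 'h) \<Rightarrow> ('b \<Rightarrow> 'h) \<Rightarrow> 'b \<Rightarrow> 'h" where
  "compress T \<phi> w = T (extend \<phi>) (\<tau> w)"

lemma inj_\<tau>: "inj_on \<tau> W"
proof (rule inj_onI)
  fix u v assume uv: "u \<in> W" "v \<in> W" "\<tau> u = \<tau> v"
  then have "dW u v = 0" using isometric[of u v] \<tau>_in Y.zero by simp
  then show "u = v" using uv W.zero by simp
qed

lemma \<sigma>_\<tau>: "w \<in> W \<Longrightarrow> \<sigma> (\<tau> w) = w"
  by (simp add: \<sigma>_def inj_\<tau>)

lemma image_subset: "\<tau> ` W \<subseteq> Y"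
  using \<tau>_in by blast

lemma image_sets: "\<tau> ` W \<inter> space \<nu> \<in> sets \<nu>"
  using image_subset sets_\<nu> by auto

lemma space_pull: "space pull = W" and sets_pull: "sets pull = Pow W"
  by (auto simp: pull_def)

lemma space_restrict: "space (restrict_space \<nu> (\<tau> ` W)) = \<tau> ` W"
  using image_subset space_\<nu> by (auto simp: space_restrict_space)

lemma sets_restrict: "sets (restrict_space \<nu> (\<tau> ` W)) = Pow (\<tau> ` W)"
proof
  show "Pow (\<tau> ` W) \<subseteq> sets (restrict_space \<nu> (\<tau> ` W))"
  proof
    fix A assume "A \<in> Pow (\<tau> ` W)"
    then have "A = \<tau> ` W \<inter> A" "A \<in> Pow Y" using image_subset by auto
    then show "A \<in> sets (restrict_space \<nu> (\<tau> ` W))"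
      unfolding sets_restrict_space sets_\<nu> by (rule image_eqI)
  qed
qed (auto simp: sets_restrict_space)

lemma \<sigma>_measurable: "\<sigma> \<in> measurable (restrict_space \<nu> (\<tau> ` W)) (count_space W)"
  by (rule measurable_Pow) (auto simp: space_restrict sets_restrict \<sigma>_\<tau>)

lemma borel_measurable_\<nu>:
  fixes f :: "'a \<Rightarrow> 'c::topological_space"
  shows "f \<in> borel_measurable \<nu>"
  by (rule borel_measurable_Pow) (simp add: space_\<nu> sets_\<nu>)

lemma integrable_pull:
  fixes f :: "'b \<Rightarrow> 'c::{banach, second_countable_topology}"
  shows "integrable pull f \<longleftrightarrow> integrable \<nu> (extend f)"
proof -
  have "integrable pull f \<longleftrightarrow> integrable (restrict_space \<nu> (\<tau> ` W)) (\<lambda>y. f (\<sigma> y))"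
    unfolding pull_def by (rule integrable_distr_eq[OF \<sigma>_measurable]) simp
  also have "\<dots> \<longleftrightarrow> integrable \<nu> (\<lambda>y. indicator (\<tau> ` W) y *\<^sub>R f (\<sigma> y))"
    by (rule integrable_restrict_space[OF image_sets])
  also have "(\<lambda>y. indicator (\<tau> ` W) y *\<^sub>R f (\<sigma> y)) = extend f"
    by (auto simp: extend_def fun_eq_iff)
  finally show ?thesis .
qed

lemma integral_pull:
  fixes f :: "'b \<Rightarrow> 'c::{banach, second_countable_topology}"
  shows "integral\<^sup>L pull f = integral\<^sup>L \<nu> (extend f)"
proof -
  have "integral\<^sup>L pull f = integral\<^sup>L (restrict_space \<nu> (\<tau> ` W)) (\<lambda>y. f (\<sigma> y))"
    unfolding pull_def by (rule integral_distr[OF \<sigma>_measurable]) simp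
  also have "\<dots> = integral\<^sup>L \<nu> (\<lambda>y. indicator (\<tau> ` W) y *\<^sub>R f (\<sigma> y))"
    by (rule integral_restrict_space[OF image_sets])
  also have "(\<lambda>y. indicator (\<tau> ` W) y *\<^sub>R f (\<sigma> y)) = extend f"
    by (auto simp: extend_def fun_eq_iff)
  finally show ?thesis .
qed

lemma emeasure_pull:
  assumes "A \<subseteq> W"
  shows "emeasure pull A = emeasure \<nu> (\<tau> ` A)"
proof -
  have "\<sigma> -` A \<inter> space (restrict_space \<nu> (\<tau> ` W)) = \<tau> ` A"
    using assms by (auto simp: space_restrict \<sigma>_\<tau>)
  then have "emeasure pull A = emeasure (restrict_space \<nu> (\<tau> ` W)) (\<tau> ` A)"
    unfolding pull_def using assms by (simp add: emeasure_distr[OF \<sigma>_measurable])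
  also have "\<dots> = emeasure \<nu> (\<tau> ` A)"
    using assms by (intro emeasure_restrict_space[OF image_sets]) auto
  finally show ?thesis .
qed

lemma AE_pull: "(AE w in pull. P w) \<longleftrightarrow> (AE y in \<nu>. y \<in> \<tau> ` W \<longrightarrow> P (\<sigma> y))"
  unfolding pull_def by (simp add: AE_distr_iff[OF \<sigma>_measurable] AE_restrict_space_iff[OF image_sets])

lemma extend_L2:
  fixes \<phi> :: "'b \<Rightarrow> 'h::{complex_hilbert,second_countable_topology}"
  shows "extend \<phi> \<in> L2 \<nu> \<longleftrightarrow> \<phi> \<in> L2 pull"
    and "L2_norm \<nu> (extend \<phi>) = L2_norm pull \<phi>"
proof -
  have *: "(\<lambda>y. (norm (extend \<phi> y))\<^sup>2) = extend (\<lambda>w. (norm (\<phi> w))\<^sup>2)"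
    by (auto simp: extend_def fun_eq_iff)
  have "\<phi> \<in> borel_measurable pull"
    by (rule borel_measurable_Pow) (simp add: space_pull sets_pull)
  then show "extend \<phi> \<in> L2 \<nu> \<longleftrightarrow> \<phi> \<in> L2 pull"
    using integrable_pull[of "\<lambda>w. (norm (\<phi> w))\<^sup>2"] by (simp add: L2_def * borel_measurable_\<nu>)
  show "L2_norm \<nu> (extend \<phi>) = L2_norm pull \<phi>"
    using integral_pull[of "\<lambda>w. (norm (\<phi> w))\<^sup>2"] by (simp add: L2_norm_def *)
qed

lemma extend_in_L2: "\<phi> \<in> L2 pull \<Longrightarrow> extend \<phi> \<in> L2 \<nu>"
  by (simp add: extend_L2(1))

lemma extend_comp_\<tau>: "extend (\<lambda>w. f (\<tau> w)) = (\<lambda>y. if y \<in> \<tau> ` W then f y else 0)"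
  by (auto simp: extend_def fun_eq_iff \<sigma>_\<tau>)

lemma extend_compress:
  "extend (compress T \<phi>) = (\<lambda>y. if y \<in> \<tau> ` W then T (extend \<phi>) y else 0)"
  unfolding compress_def by (rule extend_comp_\<tau>)

text \<open>Supports consist of atoms, and the atoms of \<open>pull\<close> correspond under
  \<open>\<tau>\<close> to the atoms of \<open>\<nu>\<close> in the image.\<close>

lemma L2_supp_extend:
  fixes \<phi> :: "'b \<Rightarrow> 'h::{complex_hilbert,second_countable_topology}"
  shows "Y.L2_supp \<nu> (extend \<phi>) = \<tau> ` W.L2_supp pull \<phi>"
proof -
  have "emeasure pull {w} = emeasure \<nu> {\<tau> w}" if "w \<in> W" for w
    using emeasure_pull[of "{w}"] that by simp
  moreover have "extend \<phi> y \<noteq> 0 \<longleftrightarrow> (\<exists>w\<in>W. y = \<tau> w \<and> \<phi> w \<noteq> 0)" for y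
    using \<sigma>_\<tau> unfolding extend_def by (metis image_iff)
  ultimately show ?thesis
    unfolding Y.L2_supp_eq[OF space_\<nu> sets_\<nu>] W.L2_supp_eq[OF space_pull sets_pull]
    using \<tau>_in by auto
qed

lemma msetdist_image:
  assumes "A \<subseteq> W" "B \<subseteq> W"
  shows "Y.msetdist (\<tau> ` A) (\<tau> ` B) = W.msetdist A B"
  unfolding Y.msetdist_def W.msetdist_def image_image
  using assms by (intro INF_cong refl) (auto simp: isometric subset_iff)

lemma mdiam_image:
  assumes "A \<subseteq> W"
  shows "Y.mdiam (\<tau> ` A) = W.mdiam A"
  unfolding Y.mdiam_def W.mdiam_def image_image
  using assms by (intro SUP_cong refl) (auto simp: isometric subset_iff)

lemma compress_L2_norm_le:
  fixes T :: "('a \<Rightarrow> 'h::{complex_hilbert,second_countable_topology}) \<Rightarrow> 'a \<Rightarrow> 'h"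
  assumes "L2_bounded_operator \<nu> T" "\<phi> \<in> L2 pull"
  shows "L2_norm pull (compress T \<phi>) \<le> L2_norm \<nu> (T (extend \<phi>))"
proof -
  have "T (extend \<phi>) \<in> L2 \<nu>" using L2_bounded_operatorD(1) assms extend_in_L2 by blast
  then show ?thesis
    using L2_norm_restrict_mono[of "T (extend \<phi>)" \<nu> "\<tau> ` W" UNIV] image_sets
    by (simp add: extend_L2(2)[of "compress T \<phi>", symmetric] extend_compress)
qed

lemma compress_bounded:
  fixes T :: "('a \<Rightarrow> 'h::{complex_hilbert,second_countable_topology}) \<Rightarrow> 'a \<Rightarrow> 'h"
  assumes T: "L2_bounded_operator \<nu> T"
  shows "L2_bounded_operator pull (compress T)"
  unfolding L2_bounded_operator_def
proof (intro conjI ballI allI impI)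
  fix \<phi> :: "'b \<Rightarrow> 'h" assume \<phi>: "\<phi> \<in> L2 pull"
  then have "T (extend \<phi>) \<in> L2 \<nu>"
    by (intro L2_bounded_operatorD(1)[OF T] extend_in_L2)
  then have "extend (compress T \<phi>) \<in> L2 \<nu>"
    unfolding extend_compress by (rule L2_restrict) (rule image_sets)
  then show "compress T \<phi> \<in> L2 pull" by (simp add: extend_L2(1))
next
  fix \<phi> \<psi> :: "'b \<Rightarrow> 'h" assume *: "\<phi> \<in> L2 pull" "\<psi> \<in> L2 pull" "AE w in pull. \<phi> w = \<psi> w"
  from *(3) have "AE y in \<nu>. extend \<phi> y = extend \<psi> y"
    unfolding AE_pull by eventually_elim (simp add: extend_def)
  then have "AE y in \<nu>. T (extend \<phi>) y = T (extend \<psi>) y"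
    using *(1,2) by (intro L2_bounded_operatorD(2)[OF T] extend_in_L2)
  then show "AE w in pull. compress T \<phi> w = compress T \<psi> w"
    unfolding AE_pull by eventually_elim (auto simp: compress_def \<sigma>_\<tau>)
next
  fix \<phi> \<psi> :: "'b \<Rightarrow> 'h" assume *: "\<phi> \<in> L2 pull" "\<psi> \<in> L2 pull"
  have "extend (\<lambda>z. \<phi> z + \<psi> z) = (\<lambda>z. extend \<phi> z + extend \<psi> z)"
    by (auto simp: extend_def fun_eq_iff)
  moreover have "AE y in \<nu>. T (\<lambda>z. extend \<phi> z + extend \<psi> z) y = T (extend \<phi>) y + T (extend \<psi>) y"
    using * by (intro L2_bounded_operatorD(3)[OF T] extend_in_L2)
  ultimately have "AE y in \<nu>. T (extend (\<lambda>z. \<phi> z + \<psi> z)) y = T (extend \<phi>) y + T (extend \<psi>) y"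
    by simp
  then show "AE w in pull. compress T (\<lambda>z. \<phi> z + \<psi> z) w = compress T \<phi> w + compress T \<psi> w"
    unfolding AE_pull by eventually_elim (auto simp: compress_def \<sigma>_\<tau>)
next
  fix a and \<phi> :: "'b \<Rightarrow> 'h" assume *: "\<phi> \<in> L2 pull"
  have "extend (\<lambda>z. a *\<^sub>C \<phi> z) = (\<lambda>z. a *\<^sub>C extend \<phi> z)"
    by (auto simp: extend_def fun_eq_iff scaleC_zero_right)
  moreover have "AE y in \<nu>. T (\<lambda>z. a *\<^sub>C extend \<phi> z) y = a *\<^sub>C T (extend \<phi>) y"
    using * by (intro L2_bounded_operatorD(4)[OF T] extend_in_L2)
  ultimately have "AE y in \<nu>. T (extend (\<lambda>z. a *\<^sub>C \<phi> z)) y = a *\<^sub>C T (extend \<phi>) y" by simp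
  then show "AE w in pull. compress T (\<lambda>z. a *\<^sub>C \<phi> z) w = a *\<^sub>C compress T \<phi> w"
    unfolding AE_pull by eventually_elim (auto simp: compress_def \<sigma>_\<tau>)
next
  obtain C where C: "\<And>\<phi>. \<phi> \<in> L2 \<nu> \<Longrightarrow> L2_norm \<nu> (T \<phi>) \<le> C * L2_norm \<nu> \<phi>"
    using L2_bounded_operatorD(5)[OF T] by blast
  have "L2_norm pull (compress T \<phi>) \<le> C * L2_norm pull \<phi>" if "\<phi> \<in> L2 pull" for \<phi>
    using compress_L2_norm_le[OF T that] C[of "extend \<phi>"] that extend_L2[of \<phi>] by simp
  then show "\<exists>C. \<forall>\<phi>\<in>L2 pull. L2_norm pull (compress T \<phi>) \<le> C * L2_norm pull \<phi>" by blast
qed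

text \<open>\<open>\<tau>\<close> preserves the distance between supports, and
  \<open>extend \<psi>\<close> vanishes off the image. The inner product for the compression is
  therefore the one for \<open>T\<close> on the extended functions.\<close>

lemma compress_propagation:
  fixes T :: "('a \<Rightarrow> 'h::{complex_hilbert,second_countable_topology}) \<Rightarrow> 'a \<Rightarrow> 'h"
  assumes T: "T \<in> Y.propagation_operators r \<nu>"
  shows "compress T \<in> W.propagation_operators r pull"
  unfolding W.propagation_operators_def
proof (intro CollectI conjI ballI impI)
  show "L2_bounded_operator pull (compress T)"
    using T compress_bounded unfolding Y.propagation_operators_def by blast
  fix \<phi> \<psi> :: "'b \<Rightarrow> 'h"
  assume L: "\<phi> \<in> L2 pull" "\<psi> \<in> L2 pull"
    and far: "ennreal r < W.msetdist (W.L2_supp pull \<phi>) (W.L2_supp pull \<psi>)"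
  have "W.L2_supp pull \<phi> \<subseteq> W" "W.L2_supp pull \<psi> \<subseteq> W"
    unfolding W.L2_supp_def by auto
  then have "ennreal r < Y.msetdist (Y.L2_supp \<nu> (extend \<phi>)) (Y.L2_supp \<nu> (extend \<psi>))"
    unfolding L2_supp_extend using far by (simp add: msetdist_image)
  then have "L2_inner \<nu> (T (extend \<phi>)) (extend \<psi>) = 0"
    using T extend_in_L2[OF L(1)] extend_in_L2[OF L(2)] unfolding Y.propagation_operators_def by simp
  moreover have "extend (\<lambda>w. cinner (compress T \<phi> w) (\<psi> w)) =
      (\<lambda>y. cinner (T (extend \<phi>) y) (extend \<psi> y))"
    unfolding extend_def compress_def by (intro ext) (auto simp: \<sigma>_\<tau> cinner_zero_right)
  ultimately show "L2_inner pull (compress T \<phi>) \<psi> = 0"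
    unfolding L2_inner_def integral_pull by simp
qed

lemma pull_positive_locally_finite:
  assumes "Y.locally_finite \<nu>" "emeasure \<nu> (\<tau> ` W) \<noteq> 0"
  shows "W.positive_borel_measure pull" "W.locally_finite pull"
proof -
  show "W.positive_borel_measure pull"
    unfolding W.positive_borel_measure_iff
    using assms emeasure_pull[of W] by (simp add: space_pull sets_pull)
  show "W.locally_finite pull"
    unfolding W.locally_finite_def
  proof (intro ballI impI)
    fix A assume "A \<in> sets pull" and b: "W.mbounded A"
    then have A: "A \<subseteq> W" by (simp add: sets_pull)
    obtain C where C: "\<And>x y. x \<in> A \<Longrightarrow> y \<in> A \<Longrightarrow> dW x y \<le> C"
      using b unfolding W.mbounded_alt by blast
    have "Y.mbounded (\<tau> ` A)"
      unfolding Y.mbounded_alt using A C \<tau>_in isometric by (auto simp: subset_iff)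
    then show "emeasure pull A < \<infinity>"
      using assms(1) A \<tau>_in emeasure_pull[OF A]
      unfolding Y.locally_finite_def by (auto simp: sets_\<nu> subset_iff image_subset_iff)
  qed
qed

end


section \<open>Averaging over pieces and cutting down a stretched function\<close>

lemma ex_piece_ratio:
  assumes I: "countable I" and disj: "disjoint_family_on A I" "disjoint_family_on N I"
    and sets: "\<And>i. i \<in> I \<Longrightarrow> A i \<in> sets \<alpha>" "\<And>i. i \<in> I \<Longrightarrow> N i \<in> sets \<beta>"
    and less: "t * emeasure \<beta> (space \<beta>) < emeasure \<alpha> (\<Union>i\<in>I. A i)"
  shows "\<exists>i\<in>I. t * emeasure \<beta> (N i) < emeasure \<alpha> (A i)"
proof (rule ccontr)
  assume "\<not> ?thesis"
  then have le: "emeasure \<alpha> (A i) \<le> t * emeasure \<beta> (N i)" if "i \<in> I" for i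
    using that not_less by blast
  \<comment> \<open>Summing the failed inequalities over the disjoint \<open>A i\<close> and the
    disjoint \<open>N i\<close> contradicts \<open>less\<close>.\<close>
  have "emeasure \<alpha> (\<Union>i\<in>I. A i) = (\<integral>\<^sup>+i. emeasure \<alpha> (A i) \<partial>count_space I)"
    using I disj sets by (intro emeasure_UN_countable) auto
  also have "\<dots> \<le> (\<integral>\<^sup>+i. t * emeasure \<beta> (N i) \<partial>count_space I)"
    using le by (intro nn_integral_mono) auto
  also have "\<dots> = t * (\<integral>\<^sup>+i. emeasure \<beta> (N i) \<partial>count_space I)"
    by (intro nn_integral_cmult) auto
  also have "(\<integral>\<^sup>+i. emeasure \<beta> (N i) \<partial>count_space I) = emeasure \<beta> (\<Union>i\<in>I. N i)"
    using I disj sets by (intro emeasure_UN_countable[symmetric]) auto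
  also have "t * \<dots> \<le> t * emeasure \<beta> (space \<beta>)"
    by (intro mult_left_mono emeasure_space) auto
  finally show False using less by simp
qed

text \<open>Let \<open>K = L * (k + 1)\<close>. For a piece \<open>B\<close> of a sparse family in
  \<open>X\<close>, let \<open>A B\<close> be its preimage and \<open>N B\<close> the preimage of
  its \<open>K\<close>-neighbourhood. By the Lipschitz bound, points off \<open>N B\<close> are at
  distance at least \<open>k + 1\<close> from \<open>A B\<close>, so on \<open>A B\<close> the
  function \<open>T \<psi>\<close> depends only on \<open>\<psi>\<close> inside \<open>N B\<close>.
  By \<open>2 * K < m\<close> the sets \<open>N B\<close> are disjoint, and averaging finds a piece
  with the required ratio.\<close>

lemma (in uniformly_discrete_metric_space) ex_localized_restriction:
  fixes T :: "('a \<Rightarrow> 'h::{complex_hilbert,second_countable_topology}) \<Rightarrow> 'a \<Rightarrow> 'h"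
    and \<pi> :: "'a \<Rightarrow> 'x"
  assumes X: "Metric_space X dX" and \<pi>: "\<And>y. y \<in> M \<Longrightarrow> \<pi> y \<in> X"
    and lip: "\<And>x y. x \<in> M \<Longrightarrow> y \<in> M \<Longrightarrow> dX (\<pi> x) (\<pi> y) \<le> L * d x y" and L: "0 \<le> L"
    and cM: "countable M" and k: "0 \<le> k"
    and sp: "Metric_space.sparsifies X dX c m D" and m: "2 * (L * (k + 1)) < m"
    and \<nu>: "positive_borel_measure \<nu>" and T: "T \<in> propagation_operators k \<nu>"
    and \<psi>: "\<psi> \<in> L2 \<nu>" and t: "0 \<le> t"
    and big: "t * (L2_norm \<nu> \<psi>)\<^sup>2 < c * (L2_norm \<nu> (T \<psi>))\<^sup>2"
  obtains y0 N where "y0 \<in> M" "N \<subseteq> M" "\<And>y. y \<in> N \<Longrightarrow> dX (\<pi> y0) (\<pi> y) \<le> D + L * (k + 1)"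
    "t * (L2_norm \<nu> (\<lambda>z. if z \<in> N then \<psi> z else 0))\<^sup>2 <
     (L2_norm \<nu> (\<lambda>y. if y \<in> N then T (\<lambda>z. if z \<in> N then \<psi> z else 0) y else 0))\<^sup>2"
proof -
  interpret X: Metric_space X dX by (rule X)
  have sp\<nu>: "space \<nu> = M" and s\<nu>: "sets \<nu> = Pow M"
    using \<nu> positive_borel_measure_iff by auto
  have meas: "A \<inter> space \<nu> \<in> sets \<nu>" for A using sp\<nu> s\<nu> by auto
  have bT: "L2_bounded_operator \<nu> T" using T by (simp add: propagation_operators_def)
  have T\<psi>: "T \<psi> \<in> L2 \<nu>" by (rule L2_bounded_operatorD(1)[OF bT \<psi>])
  \<comment> \<open>The added 1 yields distances strictly above \<open>k\<close>, as the propagation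
    condition demands.\<close>
  define K where "K = L * (k + 1)"
  have K: "0 \<le> K" "2 * K < m" using L k m by (auto simp: K_def)
  define \<alpha> where "\<alpha> = density \<nu> (\<lambda>y. ennreal ((norm (T \<psi> y))\<^sup>2))"
  define \<beta> where "\<beta> = density \<nu> (\<lambda>y. ennreal ((norm (\<psi> y))\<^sup>2))"
  \<comment> \<open>The mass of \<open>T \<psi>\<close> is sparsified, not that of
    \<open>\<psi>\<close>: the sets \<open>A B\<close> must retain the share \<open>c\<close> of the
    former, while for the latter disjointness of the sets \<open>N B\<close> suffices.\<close>
  define \<mu> where "\<mu> = distr \<alpha> (sigma X {U. openin X.mtopology U}) \<pi>"
  have s\<alpha>: "space \<alpha> = M" "sets \<alpha> = Pow M" and s\<beta>: "space \<beta> = M" "sets \<beta> = Pow M"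
    using sp\<nu> s\<nu> by (auto simp: \<alpha>_def \<beta>_def)
  have em\<alpha>: "emeasure \<alpha> A = ennreal ((L2_norm \<nu> (\<lambda>y. if y \<in> A then T \<psi> y else 0))\<^sup>2)"
    if "A \<subseteq> M" for A unfolding \<alpha>_def using that T\<psi> s\<nu> by (intro emeasure_density_L2) auto
  have em\<beta>: "emeasure \<beta> A = ennreal ((L2_norm \<nu> (\<lambda>y. if y \<in> A then \<psi> y else 0))\<^sup>2)"
    if "A \<subseteq> M" for A unfolding \<beta>_def using that \<psi> s\<nu> by (intro emeasure_density_L2) auto
  have whole: "L2_norm \<nu> (\<lambda>y. if y \<in> M then \<phi> y else 0) = L2_norm \<nu> \<phi>" for \<phi> :: "'a \<Rightarrow> 'h"
    unfolding L2_norm_def using sp\<nu> by (auto intro!: arg_cong[of _ _ sqrt] Bochner_Integration.integral_cong)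
  have opens: "{U. openin X.mtopology U} \<subseteq> Pow X"
    using openin_subset[of X.mtopology] by auto
  have \<pi>m: "\<pi> \<in> measurable \<alpha> (sigma X {U. openin X.mtopology U})"
    by (rule measurable_Pow) (use \<pi> opens s\<alpha> in \<open>auto simp: space_measure_of\<close>)
  have s\<mu>: "space \<mu> = X" "sets \<mu> = sigma_sets X {U. openin X.mtopology U}"
    unfolding \<mu>_def using opens by (auto simp: space_measure_of sets_measure_of)
  have em\<mu>: "emeasure \<mu> A = emeasure \<alpha> {y \<in> M. \<pi> y \<in> A}" if "A \<in> sets \<mu>" for A
    using that unfolding \<mu>_def
    by (subst emeasure_distr[OF \<pi>m]) (auto simp: s\<alpha> intro!: arg_cong2[of _ _ _ _ emeasure])
  have X\<mu>: "X \<in> sets \<mu>" using s\<mu>(1) by (metis sets.top)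
  have "{y \<in> M. \<pi> y \<in> X} = M" using \<pi> by auto
  then have total: "emeasure \<mu> X = ennreal ((L2_norm \<nu> (T \<psi>))\<^sup>2)"
    using em\<mu>[OF X\<mu>] em\<alpha>[of M] by (simp add: whole)
  \<comment> \<open>Since \<open>t \<ge> 0\<close>, the assumption \<open>big\<close> forces
    \<open>T \<psi>\<close> to be nonzero, so that \<open>\<mu>\<close> is a positive
    measure.\<close>
  have "0 \<le> t * (L2_norm \<nu> \<psi>)\<^sup>2" using t by simp
  then have "L2_norm \<nu> (T \<psi>) \<noteq> 0" using big by auto
  then have "X.positive_borel_measure \<mu>"
    using s\<mu> total by (simp add: X.positive_borel_measure_def ennreal_eq_0_iff)
  moreover have fin: "finite_measure \<mu>"
    by (rule finite_measureI) (simp add: s\<mu> total)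
  ultimately obtain P where P: "\<Union>P \<in> sets \<mu>" "X.sparse_family m D P"
    "c * measure \<mu> X \<le> measure \<mu> (\<Union>P)"
    using sp unfolding X.sparsifies_def by blast
  have PX: "B \<subseteq> X" if "B \<in> P" for B
    using sets.sets_into_space[OF P(1)] s\<mu>(1) that by blast
  have sep: "m \<le> dX a b" if "B \<in> P" "B' \<in> P" "B \<noteq> B'" "a \<in> B" "b \<in> B'" for B B' a b
    using P(2) that unfolding X.sparse_family_def by metis
  have diam: "dX a b \<le> D" if "B \<in> P" "a \<in> B" "b \<in> B" for B a b
    using P(2) that unfolding X.sparse_family_def by metis
  define A where "A B = {y \<in> M. \<pi> y \<in> B}" for B
  define N where "N B = {y \<in> M. \<exists>x\<in>B. dX (\<pi> y) x \<le> K}" for B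
  \<comment> \<open>Pieces with empty preimage carry no mass. The others are countably many, because
    choosing a point in each preimage injects them into \<open>M\<close>.\<close>
  define I where "I = {B \<in> P. A B \<noteq> {}}"
  have N_disj: "B = B'" if BB: "B \<in> P" "B' \<in> P" and yN: "y \<in> N B" "y \<in> N B'" for B B' y
  proof (rule ccontr)
    assume "B \<noteq> B'"
    obtain x where x: "x \<in> B" "dX (\<pi> y) x \<le> K" and y: "y \<in> M" using yN unfolding N_def by blast
    obtain x' where x': "x' \<in> B'" "dX (\<pi> y) x' \<le> K" using yN unfolding N_def by blast
    have "dX x x' \<le> dX x (\<pi> y) + dX (\<pi> y) x'"
      using X.triangle[of x "\<pi> y" x'] PX BB x(1) x'(1) \<pi>[OF y] by blast
    then show False
      using sep[OF BB \<open>B \<noteq> B'\<close> x(1) x'(1)] x(2) x'(2) K X.commute[of x "\<pi> y"] by linarith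
  qed
  have AN: "A B \<subseteq> N B" for B
  proof
    fix y assume "y \<in> A B"
    then have "y \<in> M" "\<pi> y \<in> B" "dX (\<pi> y) (\<pi> y) \<le> K" using K(1) \<pi> unfolding A_def by auto
    then show "y \<in> N B" unfolding N_def by blast
  qed
  have "countable I"
  proof (rule countable_image_inj_on)
    let ?g = "\<lambda>B. SOME y. y \<in> A B"
    have g: "?g B \<in> A B" if "B \<in> I" for B
      using that unfolding I_def by (auto intro: someI_ex)
    then have "?g ` I \<subseteq> M" unfolding A_def by blast
    then show "countable (?g ` I)" using cM countable_subset by blast
    show "inj_on ?g I"
    proof (rule inj_onI)
      fix B B' assume BB: "B \<in> I" "B' \<in> I" "?g B = ?g B'"
      then have "?g B \<in> N B" "?g B \<in> N B'" using g[of B] g[of B'] AN by auto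
      then show "B = B'" using N_disj[of B B'] BB(1,2) unfolding I_def by blast
    qed
  qed
  moreover have "disjoint_family_on N I" "disjoint_family_on A I"
    unfolding disjoint_family_on_def using N_disj AN unfolding I_def by blast+
  moreover have "ennreal t * emeasure \<beta> (space \<beta>) < emeasure \<alpha> (\<Union>B\<in>I. A B)"
  proof -
    have "(\<Union>B\<in>I. A B) = {y \<in> M. \<pi> y \<in> \<Union>P}" unfolding I_def A_def by blast
    then have "emeasure \<alpha> (\<Union>B\<in>I. A B) = ennreal (measure \<mu> (\<Union>P))"
      using em\<mu>[OF P(1)] finite_measure.emeasure_eq_measure[OF fin] by simp
    moreover have "measure \<mu> X = (L2_norm \<nu> (T \<psi>))\<^sup>2"
      using total by (simp add: measure_def)
    then have "t * (L2_norm \<nu> \<psi>)\<^sup>2 < measure \<mu> (\<Union>P)" using P(3) big by simp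
    then have "ennreal (t * (L2_norm \<nu> \<psi>)\<^sup>2) < ennreal (measure \<mu> (\<Union>P))"
      using t by (simp add: ennreal_lessI order.strict_trans1[of 0 "t * (L2_norm \<nu> \<psi>)\<^sup>2"])
    ultimately show ?thesis
      using em\<beta>[of M] t by (simp add: s\<beta> whole ennreal_mult)
  qed
  moreover have "A B \<in> sets \<alpha>" "N B \<in> sets \<beta>" for B
    using s\<alpha> s\<beta> unfolding A_def N_def by auto
  ultimately obtain B where B: "B \<in> I" "ennreal t * emeasure \<beta> (N B) < emeasure \<alpha> (A B)"
    using ex_piece_ratio[of I A N \<alpha> \<beta> "ennreal t"] by blast
  obtain y0 where y0: "y0 \<in> M" "\<pi> y0 \<in> B" "B \<in> P" using B(1) unfolding I_def A_def by blast
  define \<psi>' where "\<psi>' = (\<lambda>z. if z \<in> N B then \<psi> z else 0)"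
  have \<psi>': "\<psi>' \<in> L2 \<nu>" unfolding \<psi>'_def using \<psi> meas by (rule L2_restrict)
  have T\<psi>': "T \<psi>' \<in> L2 \<nu>" by (rule L2_bounded_operatorD(1)[OF bT \<psi>'])
  have "k + 1 \<le> d y a" if a: "a \<in> A B" and y: "y \<in> M - N B" for a y
  proof -
    have "\<not> dX (\<pi> y) (\<pi> a) \<le> K" "a \<in> M" using a y unfolding A_def N_def by auto
    then have "L * (k + 1) < L * d y a" using lip[of y a] y unfolding K_def by simp
    \<comment> \<open>The strict inequality excludes \<open>L = 0\<close>, so \<open>L\<close> can
      be cancelled.\<close>
    then show ?thesis using L by (simp add: mult_less_cancel_left)
  qed
  then have "AE y in \<nu>. y \<in> A B \<longrightarrow> T \<psi>' y = T \<psi> y"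
    unfolding \<psi>'_def using k by (intro propagation_localize[OF T sp\<nu> s\<nu> \<psi>, of "k + 1"]) auto
  then have "AE y in \<nu>. (if y \<in> A B then T \<psi> y else 0) = (if y \<in> A B then T \<psi>' y else 0)"
    by eventually_elim auto
  then have "L2_norm \<nu> (\<lambda>y. if y \<in> A B then T \<psi> y else 0) =
      L2_norm \<nu> (\<lambda>y. if y \<in> A B then T \<psi>' y else 0)"
    using sp\<nu> s\<nu> by (intro L2_norm_cong_AE borel_measurable_Pow) auto
  \<comment> \<open>Enlarging the output window from \<open>A B\<close> to \<open>N B\<close> puts
    input and output on the same set, as a compression requires.\<close>
  also have "\<dots> \<le> L2_norm \<nu> (\<lambda>y. if y \<in> N B then T \<psi>' y else 0)"
    using T\<psi>' meas meas AN by (rule L2_norm_restrict_mono)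
  finally have "(L2_norm \<nu> (\<lambda>y. if y \<in> A B then T \<psi> y else 0))\<^sup>2 \<le>
      (L2_norm \<nu> (\<lambda>y. if y \<in> N B then T \<psi>' y else 0))\<^sup>2"
    by (intro power_mono) auto
  moreover have "t * (L2_norm \<nu> \<psi>')\<^sup>2 < (L2_norm \<nu> (\<lambda>y. if y \<in> A B then T \<psi> y else 0))\<^sup>2"
  proof -
    have "A B \<subseteq> M" "N B \<subseteq> M" unfolding A_def N_def by auto
    then have "ennreal (t * (L2_norm \<nu> \<psi>')\<^sup>2) <
        ennreal ((L2_norm \<nu> (\<lambda>y. if y \<in> A B then T \<psi> y else 0))\<^sup>2)"
      using B(2) em\<alpha> em\<beta> t by (simp add: \<psi>'_def ennreal_mult)
    then show ?thesis using t by (simp add: ennreal_less_iff)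
  qed
  ultimately have "t * (L2_norm \<nu> \<psi>')\<^sup>2 < (L2_norm \<nu> (\<lambda>y. if y \<in> N B then T \<psi>' y else 0))\<^sup>2"
    by linarith
  moreover have "dX (\<pi> y0) (\<pi> y) \<le> D + L * (k + 1)" if yN: "y \<in> N B" for y
  proof -
    obtain x where x: "x \<in> B" "dX (\<pi> y) x \<le> K" "y \<in> M" using yN unfolding N_def by blast
    have "x \<in> X" using PX y0(3) x(1) by blast
    then have "dX (\<pi> y0) (\<pi> y) \<le> dX (\<pi> y0) x + dX x (\<pi> y)"
      using X.triangle \<pi> y0(1) x(3) by blast
    then show ?thesis
      using diam[OF y0(3,2) x(1)] x(2) X.commute[of x "\<pi> y"] unfolding K_def by linarith
  qed
  moreover have "N B \<subseteq> M" unfolding N_def by blast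
  ultimately show ?thesis using that[OF y0(1)] unfolding \<psi>'_def by blast
qed


subsection \<open>Isometric actions of finitely generated groups\<close>

locale isometric_group_action =
  group G + X: Metric_space X d + act: group_action G X act
  for G :: "('g, 'b) monoid_scheme" (structure) and X :: "'x set" and d :: "'x \<Rightarrow> 'x \<Rightarrow> real"
    and act :: "'g \<Rightarrow> 'x \<Rightarrow> 'x" +
  fixes S :: "'g set" and x0 :: 'x
  assumes finite_S: "finite S" and S_carrier: "S \<subseteq> carrier G" and S_generates: "generate G S = carrier G"
    and isometric: "g \<in> carrier G \<Longrightarrow> x \<in> X \<Longrightarrow> y \<in> X \<Longrightarrow> d (act g x) (act g y) = d x y"
    and x0: "x0 \<in> X"
begin

abbreviation \<pi> :: "'g \<Rightarrow> 'x" where "\<pi> g \<equiv> act g x0"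

abbreviation W :: "real \<Rightarrow> 'g set" where "W \<equiv> k_stabilizer G X d act x0"

lemma \<pi>_in: "g \<in> carrier G \<Longrightarrow> \<pi> g \<in> X"
  using act.element_image x0 by blast

lemma \<pi>_one: "\<pi> \<one> = x0"
  using act.id_eq_one x0 by (metis restrict_apply)

lemma dist_\<pi>_translate:
  "g \<in> carrier G \<Longrightarrow> h \<in> carrier G \<Longrightarrow> d (\<pi> g) (\<pi> (g \<otimes> h)) = d x0 (\<pi> h)"
  using act.composition_rule[OF x0] isometric x0 \<pi>_in by simp

lemma dist_\<pi>:
  assumes "g \<in> carrier G" "h \<in> carrier G"
  shows "d (\<pi> g) (\<pi> h) = d x0 (\<pi> (inv g \<otimes> h))"
proof -
  have "g \<otimes> (inv g \<otimes> h) = h" using assms by (simp add: m_assoc[symmetric])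
  then show ?thesis using dist_\<pi>_translate[of g "inv g \<otimes> h"] assms by simp
qed

lemma W_eq: "W R = {g \<in> carrier G. d x0 (\<pi> g) \<le> R}"
  unfolding k_stabilizer_def using \<pi>_in x0 by (auto simp: X.mcball_def)

text \<open>A Lipschitz constant for the orbit map. The sum bounds every displacement of a generator
  and, unlike a maximum, makes sense for empty \<open>S\<close>.\<close>

definition L :: real where "L = (\<Sum>s\<in>S. d x0 (\<pi> s))"

lemma L_nonneg: "0 \<le> L"
  unfolding L_def by (intro sum_nonneg) simp

lemma dist_letter:
  assumes "a \<in> S \<union> (\<lambda>s. inv s) ` S"
  shows "d x0 (\<pi> a) \<le> L"
proof -
  have S: "d x0 (\<pi> s) \<le> L" if "s \<in> S" for s
    unfolding L_def using finite_S that by (intro member_le_sum) auto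
  \<comment> \<open>Applying the isometry \<open>act s\<close> to both points shows that
    \<open>inv s\<close> displaces \<open>x0\<close> as far as \<open>s\<close> does.\<close>
  moreover have "d x0 (\<pi> (inv s)) = d x0 (\<pi> s)" if "s \<in> S" for s
    using dist_\<pi>[of s \<one>] that S_carrier by (simp add: \<pi>_one subset_iff X.commute)
  ultimately show ?thesis using assms by auto
qed

text \<open>The first letter moves \<open>x0\<close> by at most \<open>L\<close> and translates the
  path of the remaining word isometrically.\<close>

lemma dist_word:
  "set w \<subseteq> S \<union> (\<lambda>s. inv s) ` S \<Longrightarrow> d x0 (\<pi> (foldr (\<otimes>) w \<one>)) \<le> L * real (length w)"
proof (induction w)
  case Nil
  then show ?case using x0 by (simp add: \<pi>_one)
next
  case (Cons a w)
  let ?v = "foldr (\<otimes>) w \<one>"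
  have a: "a \<in> carrier G" and v: "?v \<in> carrier G"
    using Cons.prems letters_in_carrier[OF S_carrier] foldr_mult_closed[of w] by auto
  have "d x0 (\<pi> (a \<otimes> ?v)) \<le> d x0 (\<pi> a) + d (\<pi> a) (\<pi> (a \<otimes> ?v))"
    using a v x0 \<pi>_in by (intro X.triangle) auto
  also have "\<dots> \<le> L + L * real (length w)"
    using dist_letter[of a] Cons dist_\<pi>_translate[OF a v] by (intro add_mono) auto
  finally show ?case by (simp add: algebra_simps)
qed

lemma \<pi>_Lipschitz:
  assumes "g \<in> carrier G" "h \<in> carrier G"
  shows "d (\<pi> g) (\<pi> h) \<le> L * word_metric G S g h"
proof -
  have gh: "inv g \<otimes> h \<in> carrier G" using assms by simp
  obtain w where w: "set w \<subseteq> S \<union> (\<lambda>s. inv s) ` S" "inv g \<otimes> h = foldr (\<otimes>) w \<one>"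
    "length w = word_length G S (inv g \<otimes> h)"
    using obtain_word[OF S_carrier S_generates gh] by metis
  then show ?thesis using dist_word[OF w(1)] assms by (simp add: dist_\<pi> word_metric_def)
qed

lemma countable_carrier: "countable (carrier G)"
proof -
  let ?A = "S \<union> (\<lambda>s. inv s) ` S"
  have "carrier G \<subseteq> (\<lambda>w. foldr (\<otimes>) w \<one>) ` lists ?A"
  proof
    fix g assume "g \<in> carrier G"
    then obtain w where "set w \<subseteq> ?A" "g = foldr (\<otimes>) w \<one>"
      using ex_word[OF S_carrier] S_generates by metis
    then show "g \<in> (\<lambda>w. foldr (\<otimes>) w \<one>) ` lists ?A" by (auto simp: lists_eq_set)
  qed
  moreover have "countable (lists ?A)"
    using finite_S by (intro countable_lists countable_finite) simp
  then have "countable ((\<lambda>w. foldr (\<otimes>) w \<one>) ` lists ?A)" by (rule countable_image)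
  ultimately show ?thesis by (rule countable_subset)
qed

lemma uniformly_discrete_subset:
  assumes "A \<subseteq> carrier G"
  shows "uniformly_discrete_metric_space A (word_metric G S)"
proof -
  interpret Y: Metric_space "carrier G" "word_metric G S"
    by (rule Metric_space_word_metric[OF S_carrier S_generates])
  interpret A: Metric_space A "word_metric G S"
    using assms by (rule Y.subspace)
  show ?thesis
  proof
    fix x y assume xy: "x \<in> A" "y \<in> A" "x \<noteq> y"
    then have "word_metric G S x y \<noteq> 0" using A.zero by simp
    then show "1 \<le> word_metric G S x y" by (auto simp: word_metric_def split: if_splits)
  qed
qed

text \<open>The factor \<open>g\<close> cancels in the quotient that defines the distance. Left
  translation therefore embeds each \<open>W R\<close> isometrically into the group.\<close>

lemma word_metric_translate:
  assumes "g \<in> carrier G" "u \<in> carrier G" "v \<in> carrier G"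
  shows "word_metric G S (g \<otimes> u) (g \<otimes> v) = word_metric G S u v"
proof -
  have "inv g \<otimes> (g \<otimes> v) = v" using assms by (simp add: m_assoc[symmetric])
  then have "inv (g \<otimes> u) \<otimes> (g \<otimes> v) = inv u \<otimes> v"
    using assms by (simp add: inv_mult_group m_assoc)
  then show ?thesis using assms by (simp add: word_metric_def)
qed

text \<open>
  The orbit is connected at scale \<open>L\<close>, so a decomposition of full measure into pieces that are more
  than \<open>L\<close> apart has a single piece meeting it.
\<close>

lemma orbit_bounded:
  assumes ms: "X.metric_sparsification 1"
  obtains R where "0 < R" "W R = carrier G"
proof -
  \<comment> \<open>The scale \<open>L + 1\<close> exceeds the length \<open>L\<close> of a step
    along the orbit.\<close>
  obtain D where D: "0 \<le> D" "X.sparsifies 1 (L + 1) D"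
    using X.metric_sparsification_sparsifies[OF ms] .
  have "d x0 (\<pi> g) \<le> D" if g: "g \<in> carrier G" for g
  proof -
    let ?A = "S \<union> (\<lambda>s. inv s) ` S"
    obtain w where w: "set w \<subseteq> ?A" "g = foldr (\<otimes>) w \<one>"
      using ex_word[OF S_carrier] S_generates g by metis
    have tc: "foldr (\<otimes>) (take n w) \<one> \<in> carrier G" for n
      using w(1) letters_in_carrier[OF S_carrier] set_take_subset[of n w]
      by (intro foldr_mult_closed) blast
    define p where "p n = \<pi> (foldr (\<otimes>) (take n w) \<one>)" for n
    have pX: "p n \<in> X" for n unfolding p_def by (rule \<pi>_in[OF tc])
    have p0: "p 0 = x0" by (simp add: p_def \<pi>_one)
    have pw: "p (length w) = \<pi> g" by (simp add: p_def w)
    have step: "d (p n) (p (Suc n)) \<le> L" if n: "n < length w" for n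
    proof -
      have a: "w ! n \<in> ?A" using n w(1) nth_mem by blast
      then have ac: "w ! n \<in> carrier G" using letters_in_carrier[OF S_carrier] by blast
      have "set (take n w) \<subseteq> carrier G"
        using w(1) letters_in_carrier[OF S_carrier] set_take_subset[of n w] by blast
      then have "foldr (\<otimes>) (take (Suc n) w) \<one> = foldr (\<otimes>) (take n w) \<one> \<otimes> w ! n"
        using foldr_mult_append[of "take n w" "[w ! n]"] ac n
        by (simp add: take_Suc_conv_app_nth del: foldr_append)
      then show ?thesis
        using dist_\<pi>_translate[OF tc ac] dist_letter[OF a] by (simp add: p_def)
    qed
    define F where "F = p ` {..length w}"
    have F: "finite F" "F \<subseteq> X" "F \<noteq> {}" using pX by (auto simp: F_def)
    \<comment> \<open>Counting measure on the finite path from \<open>x0\<close> to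
      \<open>\<pi> g\<close> through the prefixes of a word for \<open>g\<close>, moved to the Borel
      sets of \<open>X\<close>.\<close>
    define \<mu> where "\<mu> = distr (count_space F) (sigma X {U. openin X.mtopology U}) (\<lambda>x. x)"
    have opens: "{U. openin X.mtopology U} \<subseteq> Pow X"
      using openin_subset[of X.mtopology] by auto
    have m: "(\<lambda>x. x) \<in> measurable (count_space F) (sigma X {U. openin X.mtopology U})"
      using F(2) by (auto simp: space_measure_of[OF opens])
    have s\<mu>: "space \<mu> = X" "sets \<mu> = sigma_sets X {U. openin X.mtopology U}"
      unfolding \<mu>_def using opens by (auto simp: space_measure_of sets_measure_of)
    have em: "emeasure \<mu> A = of_nat (card (A \<inter> F))" if A: "A \<in> sets \<mu>" for A
    proof -
      have "emeasure \<mu> A = emeasure (count_space F) (A \<inter> F)"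
        using A unfolding \<mu>_def by (subst emeasure_distr[OF m]) auto
      then show ?thesis using F(1) by (simp add: emeasure_count_space)
    qed
    have X\<mu>: "X \<in> sets \<mu>" using s\<mu>(1) by (metis sets.top)
    have emX: "emeasure \<mu> X = of_nat (card F)" using em[OF X\<mu>] F(2) by (simp add: Int_absorb1)
    have "X.positive_borel_measure \<mu>"
      using s\<mu> emX F by (simp add: X.positive_borel_measure_def)
    moreover have "finite_measure \<mu>"
      by (rule finite_measureI) (simp add: s\<mu> emX)
    ultimately obtain P where P: "\<Union>P \<in> sets \<mu>" "X.sparse_family (L + 1) D P"
      "1 * measure \<mu> X \<le> measure \<mu> (\<Union>P)"
      using D(2) unfolding X.sparsifies_def by blast
    \<comment> \<open>With constant 1 the pieces carry the whole counting measure, hence they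
      contain every point of the path.\<close>
    have "card F \<le> card (\<Union>P \<inter> F)"
      using P(3) em[OF P(1)] emX by (simp add: measure_def)
    then have "\<Union>P \<inter> F = F" using F(1) by (intro card_seteq) auto
    then have FP: "F \<subseteq> \<Union>P" by blast
    have sep: "L + 1 \<le> d a b" if "B \<in> P" "B' \<in> P" "B \<noteq> B'" "a \<in> B" "b \<in> B'" for B B' a b
      using P(2) that unfolding X.sparse_family_def by metis
    have "p 0 \<in> F" by (simp add: F_def)
    then obtain B where B: "B \<in> P" "p 0 \<in> B" using FP by blast
    have "n \<le> length w \<Longrightarrow> p n \<in> B" for n
    proof (induction n)
      case (Suc n)
      have "p (Suc n) \<in> F" using Suc.prems unfolding F_def by blast
      then obtain B' where B': "B' \<in> P" "p (Suc n) \<in> B'" using FP by blast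
      \<comment> \<open>Consecutive points are at most \<open>L\<close> apart, whereas distinct
        pieces are at least \<open>L + 1\<close> apart.\<close>
      have "B = B'"
        using sep[OF B(1) B'(1) _ _ B'(2)] Suc step[of n] by fastforce
      then show ?case using B' by simp
    qed (rule B(2))
    then have "p (length w) \<in> B" by simp
    then show ?thesis
      using P(2) B unfolding X.sparse_family_def p0 pw by metis
  qed
  then have "W (D + 1) = carrier G"
    unfolding W_eq by force
  then show ?thesis using that[of "D + 1"] D(1) by simp
qed

text \<open>\<open>F\<close> is quantified before \<open>\<nu>\<close> and \<open>T\<close>: the
  scale, the diameter bound and the radius \<open>R\<close> depend only on \<open>k\<close>, and
  hence so does the stabilizer whose localization function is used. A positive norm leaves room for
  a strictly smaller value that some function exceeds.\<close>

lemma localize_operator: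
  assumes ms: "X.metric_sparsification c" and c: "0 < c" "c < 1" and c': "0 < c'"
    and onl: "\<And>R. 0 < R \<Longrightarrow> Metric_space.operator_norm_localization (W R) (word_metric G S) TYPE('h::{complex_hilbert,second_countable_topology}) c'"
  shows "\<exists>F::nat. \<forall>\<nu>. \<forall>T :: ('g \<Rightarrow> 'h) \<Rightarrow> 'g \<Rightarrow> 'h.
    Metric_space.positive_borel_measure (carrier G) (word_metric G S) \<nu> \<longrightarrow>
    Metric_space.locally_finite (carrier G) (word_metric G S) \<nu> \<longrightarrow>
    T \<in> Metric_space.propagation_operators (carrier G) (word_metric G S) (real k) \<nu> \<longrightarrow>
    0 < L2_opnorm \<nu> T \<longrightarrow>
    (\<exists>\<phi>\<in>L2 \<nu>. \<not> (AE y in \<nu>. \<phi> y = 0) \<and>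
       Metric_space.mdiam (word_metric G S)
         (Metric_space.L2_supp (carrier G) (word_metric G S) \<nu> \<phi>) \<le> of_nat F \<and>
       sqrt c * c' * L2_opnorm \<nu> T * L2_norm \<nu> \<phi> \<le> L2_norm \<nu> (T \<phi>))"
proof -
  interpret Y: uniformly_discrete_metric_space "carrier G" "word_metric G S"
    by (rule uniformly_discrete_subset) simp
  \<comment> \<open>The improved constant equals \<open>1 - (1 - c) * (1 - c)\<close> and lies
    strictly above \<open>c\<close> because \<open>0 < c < 1\<close>.\<close>
  define c1 where "c1 = 2 * c - c\<^sup>2"
  have "c * c < c * 1" using c by (intro mult_strict_left_mono) auto
  then have c1: "c < c1" by (simp add: c1_def power2_eq_square)
  define m where "m = 2 * (L * (real k + 1)) + 1"
  have m: "0 < m" using L_nonneg by (simp add: m_def add_nonneg_pos)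
  obtain D where D: "0 \<le> D" "X.sparsifies c1 m D"
    using X.metric_sparsification_improve[OF ms m] unfolding c1_def .
  \<comment> \<open>\<open>D + L * (real k + 1)\<close> bounds the distance in the orbit from the
    base point of the piece; the added 1 makes \<open>R\<close> positive even if this bound
    vanishes.\<close>
  define R where "R = D + L * (real k + 1) + 1"
  have R: "0 < R" using D(1) L_nonneg by (simp add: R_def add_nonneg_pos)
  have WG: "W R \<subseteq> carrier G" unfolding W_eq by blast
  interpret W: uniformly_discrete_metric_space "W R" "word_metric G S"
    by (rule uniformly_discrete_subset[OF WG])
  obtain f :: "nat \<Rightarrow> nat" where f: "\<And>\<nu> k. \<And>T :: ('g \<Rightarrow> 'h) \<Rightarrow> ('g \<Rightarrow> 'h).
      W.positive_borel_measure \<nu> \<Longrightarrow> W.locally_finite \<nu> \<Longrightarrow>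
      T \<in> W.propagation_operators (real k) \<nu> \<Longrightarrow>
      \<exists>\<phi>\<in>L2 \<nu>. \<not> (AE y in \<nu>. \<phi> y = 0) \<and> W.mdiam (W.L2_supp \<nu> \<phi>) \<le> of_nat (f k) \<and>
         L2_norm \<nu> (T \<phi>) \<ge> c' * L2_opnorm \<nu> T * L2_norm \<nu> \<phi>"
    using onl[OF R] unfolding W.operator_norm_localization_def by metis
  show ?thesis
  proof (intro exI[of _ "f k"] allI impI)
    fix \<nu> :: "'g measure" and T :: "('g \<Rightarrow> 'h) \<Rightarrow> 'g \<Rightarrow> 'h"
    assume \<nu>: "Y.positive_borel_measure \<nu>" "Y.locally_finite \<nu>"
      and T: "T \<in> Y.propagation_operators (real k) \<nu>" and pos: "0 < L2_opnorm \<nu> T"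
    define nT where "nT = L2_opnorm \<nu> T"
    have bT: "L2_bounded_operator \<nu> T" using T by (simp add: Y.propagation_operators_def)
    have s\<nu>: "space \<nu> = carrier G" "sets \<nu> = Pow (carrier G)"
      using \<nu>(1) Y.positive_borel_measure_iff by auto
    \<comment> \<open>Chosen so that \<open>c1 * s * s = c * nT * nT\<close> while
      \<open>s < nT\<close>: the gain from \<open>c\<close> to \<open>c1\<close> pays for a norm
      that is only approximated.\<close>
    define s where "s = sqrt (c / c1) * nT"
    have "c / c1 < 1" using c c1 by simp
    then have s: "0 \<le> s" "s < nT" using c c1 pos by (auto simp: s_def nT_def)
    obtain \<psi> where \<psi>: "\<psi> \<in> L2 \<nu>" "s * L2_norm \<nu> \<psi> < L2_norm \<nu> (T \<psi>)"
      using L2_almost_opnorm[OF bT s(1)] s(2) unfolding nT_def by blast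
    have "(s * L2_norm \<nu> \<psi>)\<^sup>2 < (L2_norm \<nu> (T \<psi>))\<^sup>2"
      using \<psi>(2) s(1) by (intro power_strict_mono) auto
    then have "c1 * (s * L2_norm \<nu> \<psi>)\<^sup>2 < c1 * (L2_norm \<nu> (T \<psi>))\<^sup>2"
      using c c1 by (intro mult_strict_left_mono) auto
    moreover have "c1 * s\<^sup>2 = c * nT\<^sup>2" using c c1 by (simp add: s_def power_mult_distrib)
    ultimately have big: "c * nT\<^sup>2 * (L2_norm \<nu> \<psi>)\<^sup>2 < c1 * (L2_norm \<nu> (T \<psi>))\<^sup>2"
      by (simp add: power_mult_distrib mult.assoc[symmetric])
    obtain y0 N where y0: "y0 \<in> carrier G" and N: "N \<subseteq> carrier G"
      "\<And>y. y \<in> N \<Longrightarrow> d (\<pi> y0) (\<pi> y) \<le> D + L * (real k + 1)"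
      and loc: "c * nT\<^sup>2 * (L2_norm \<nu> (\<lambda>z. if z \<in> N then \<psi> z else 0))\<^sup>2 <
        (L2_norm \<nu> (\<lambda>y. if y \<in> N then T (\<lambda>z. if z \<in> N then \<psi> z else 0) y else 0))\<^sup>2"
      by (rule Y.ex_localized_restriction[OF X.Metric_space_axioms \<pi>_in \<pi>_Lipschitz L_nonneg
            countable_carrier _ D(2) _ \<nu>(1) T \<psi>(1) _ big])
        (use c in \<open>auto simp: m_def\<close>)
    define \<psi>N where "\<psi>N = (\<lambda>z. if z \<in> N then \<psi> z else 0)"
    have \<psi>N: "\<psi>N \<in> L2 \<nu>" unfolding \<psi>N_def using s\<nu> by (intro L2_restrict[OF \<psi>(1)]) auto
    \<comment> \<open>Translation by \<open>y0\<close> carries \<open>W R\<close> onto the elements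
      whose orbit points are within \<open>R\<close> of \<open>\<pi> y0\<close>; this set contains
      \<open>N\<close>.\<close>
    interpret I: isometric_pullback "carrier G" "word_metric G S" "W R" "word_metric G S" "\<lambda>w. y0 \<otimes> w" \<nu>
      by unfold_locales (use WG y0 s\<nu> in \<open>auto simp: subset_iff word_metric_translate\<close>)
    have NV: "N \<subseteq> (\<lambda>w. y0 \<otimes> w) ` W R"
    proof
      fix y assume y: "y \<in> N"
      then have yG: "y \<in> carrier G" using N(1) by blast
      then have "inv y0 \<otimes> y \<in> W R"
        using N(2)[OF y] y0 dist_\<pi>[OF y0 yG] by (simp add: W_eq R_def)
      moreover have "y = y0 \<otimes> (inv y0 \<otimes> y)" using y0 yG by (simp add: m_assoc[symmetric])
      ultimately show "y \<in> (\<lambda>w. y0 \<otimes> w) ` W R" by blast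
    qed
    define \<psi>' where "\<psi>' = (\<lambda>w. \<psi>N (y0 \<otimes> w))"
    have ext: "I.extend \<psi>' = \<psi>N"
      unfolding \<psi>'_def I.extend_comp_\<tau> using NV by (auto simp: \<psi>N_def fun_eq_iff)
    have \<psi>': "\<psi>' \<in> L2 I.pull" using \<psi>N I.extend_L2(1)[of \<psi>'] ext by simp
    define n where "n = L2_norm I.pull \<psi>'"
    have n: "L2_norm \<nu> \<psi>N = n" "0 \<le> n" using I.extend_L2(2)[of \<psi>'] ext by (auto simp: n_def)
    define nT' where "nT' = L2_opnorm I.pull (I.compress T)"
    have bT': "L2_bounded_operator I.pull (I.compress T)" by (rule I.compress_bounded[OF bT])
    have nT': "0 \<le> nT'" unfolding nT'_def by (rule L2_opnorm_nonneg[OF bT'])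
    have "L2_norm \<nu> (\<lambda>y. if y \<in> N then T \<psi>N y else 0) \<le>
        L2_norm \<nu> (\<lambda>y. if y \<in> (\<lambda>w. y0 \<otimes> w) ` W R then T \<psi>N y else 0)"
      using s\<nu> NV by (intro L2_norm_restrict_mono L2_bounded_operatorD(1)[OF bT \<psi>N]) auto
    also have "\<dots> = L2_norm I.pull (I.compress T \<psi>')"
      using I.extend_L2(2)[of "I.compress T \<psi>'"] unfolding I.extend_compress ext .
    also have "\<dots> \<le> nT' * n" unfolding nT'_def n_def by (rule L2_norm_le_opnorm[OF bT' \<psi>'])
    finally have "(L2_norm \<nu> (\<lambda>y. if y \<in> N then T \<psi>N y else 0))\<^sup>2 \<le> (nT' * n)\<^sup>2"
      by (intro power_mono) auto
    then have less: "c * nT\<^sup>2 * n\<^sup>2 < nT'\<^sup>2 * n\<^sup>2"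
      using loc n(1) unfolding \<psi>N_def[symmetric] by (simp add: power_mult_distrib)
    then have n0: "n \<noteq> 0" by auto
    \<comment> \<open>Cancelling the square of \<open>n\<close> shows that the compression retains
      at least the share \<open>sqrt c\<close> of the norm of \<open>T\<close>.\<close>
    have "(sqrt c * nT)\<^sup>2 < nT'\<^sup>2"
      using less n0 c by (simp add: power_mult_distrib)
    then have nT_le: "sqrt c * nT \<le> nT'" using nT' by (rule power2_less_imp_less[THEN less_imp_le])
    \<comment> \<open>Were the translate null, \<open>\<psi>N\<close>, which vanishes off it, would
      have norm zero. So the pulled-back measure is nonzero, as localization on \<open>W R\<close>
      requires.\<close>
    have V: "emeasure \<nu> ((\<lambda>w. y0 \<otimes> w) ` W R) \<noteq> 0"
    proof
      assume "emeasure \<nu> ((\<lambda>w. y0 \<otimes> w) ` W R) = 0"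
      then have "(\<lambda>w. y0 \<otimes> w) ` W R \<in> null_sets \<nu>"
        using I.image_subset s\<nu> by (auto simp: null_sets_def)
      then have "AE y in \<nu>. y \<notin> (\<lambda>w. y0 \<otimes> w) ` W R" by (rule AE_not_in)
      then have "AE y in \<nu>. \<psi>N y = 0"
        by eventually_elim (use NV in \<open>auto simp: \<psi>N_def\<close>)
      then show False using L2_norm_eq_0_iff[OF \<psi>N] n0 n(1) by simp
    qed
    obtain \<phi>' where \<phi>': "\<phi>' \<in> L2 I.pull" "\<not> (AE y in I.pull. \<phi>' y = 0)"
      "W.mdiam (W.L2_supp I.pull \<phi>') \<le> of_nat (f k)"
      "c' * nT' * L2_norm I.pull \<phi>' \<le> L2_norm I.pull (I.compress T \<phi>')"
      using f[OF I.pull_positive_locally_finite[OF \<nu>(2) V] I.compress_propagation[OF T]]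
      unfolding nT'_def by blast
    \<comment> \<open>Extension by zero keeps the norm and the diameter of the support, and the
      compression of \<open>T\<close> has images of no larger norm than \<open>T\<close>
      itself.\<close>
    define \<phi> where "\<phi> = I.extend \<phi>'"
    have \<phi>: "\<phi> \<in> L2 \<nu>" unfolding \<phi>_def by (rule I.extend_in_L2[OF \<phi>'(1)])
    have norm: "L2_norm \<nu> \<phi> = L2_norm I.pull \<phi>'" unfolding \<phi>_def by (rule I.extend_L2(2))
    have "\<not> (AE y in \<nu>. \<phi> y = 0)"
      using L2_norm_eq_0_iff[OF \<phi>] L2_norm_eq_0_iff[OF \<phi>'(1)] \<phi>'(2) norm by simp
    moreover have "Y.mdiam (Y.L2_supp \<nu> \<phi>) \<le> of_nat (f k)"
      unfolding \<phi>_def I.L2_supp_extend using \<phi>'(3) I.mdiam_image[of "W.L2_supp I.pull \<phi>'"]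
      by (simp add: W.L2_supp_def)
    moreover have "sqrt c * c' * nT * L2_norm \<nu> \<phi> \<le> L2_norm \<nu> (T \<phi>)"
    proof -
      have "sqrt c * c' * nT * L2_norm \<nu> \<phi> = c' * (sqrt c * nT) * L2_norm I.pull \<phi>'"
        by (simp add: norm)
      also have "\<dots> \<le> c' * nT' * L2_norm I.pull \<phi>'"
        using nT_le c' by (intro mult_right_mono mult_left_mono) auto
      also have "\<dots> \<le> L2_norm \<nu> (T \<phi>)"
        using \<phi>'(4) I.compress_L2_norm_le[OF bT \<phi>'(1)] by (simp add: \<phi>_def)
      finally show ?thesis .
    qed
    ultimately show "\<exists>\<phi>\<in>L2 \<nu>. \<not> (AE y in \<nu>. \<phi> y = 0) \<and>
        Y.mdiam (Y.L2_supp \<nu> \<phi>) \<le> of_nat (f k) \<and>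
        sqrt c * c' * L2_opnorm \<nu> T * L2_norm \<nu> \<phi> \<le> L2_norm \<nu> (T \<phi>)"
      using \<phi> unfolding nT_def by blast
  qed
qed

end

section \<open>Uniform localization for all propagation bounds\<close>

theorem proposition5p1:
  fixes G :: "('g, 'b) monoid_scheme" and S :: "'g set"
    and X :: "'x set" and d :: "'x \<Rightarrow> 'x \<Rightarrow> real"
    and act :: "'g \<Rightarrow> 'x \<Rightarrow> 'x" and x0 :: 'x and c c' :: real
  assumes "group G"
    and "finite S" and "S \<subseteq> carrier G" and "generate G S = carrier G"
    and "Metric_space X d"
    and "group_action G X act"
    and "\<forall>g\<in>carrier G. \<forall>x\<in>X. \<forall>y\<in>X. d (act g x) (act g y) = d x y"
    and "infinite_dimensional TYPE('h::{complex_hilbert,second_countable_topology})"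
    and "0 < c" and "c \<le> 1" and "Metric_space.metric_sparsification X d c"
    and "0 < c'" and "c' \<le> 1" and "x0 \<in> X"
    and "\<forall>k>0. Metric_space.operator_norm_localization
           (k_stabilizer G X d act x0 k) (word_metric G S) TYPE('h) c'"
  shows "Metric_space.operator_norm_localization
           (carrier G) (word_metric G S) TYPE('h) (sqrt c * c')"
proof -
  interpret isometric_group_action G X d act S x0
    using assms(1-7,14)
    unfolding isometric_group_action_def isometric_group_action_axioms_def by blast
  interpret Y: uniformly_discrete_metric_space "carrier G" "word_metric G S"
    by (rule uniformly_discrete_subset) simp
  show ?thesis
  proof (cases "c = 1")
    \<comment> \<open>The orbit is bounded, so the hypothesis for one stabilizer already concerns
      the whole group, and \<open>sqrt 1 = 1\<close>.\<close>
    case True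
    then obtain R where "0 < R" "W R = carrier G"
      using orbit_bounded assms(11) by blast
    then show ?thesis using assms(15) True by force
  next
    case False
    then have c: "c < 1" using assms(10) by simp
    have onl: "Metric_space.operator_norm_localization (W R) (word_metric G S) TYPE('h) c'"
      if "0 < R" for R using assms(15) that by blast
    define good where "good F \<nu> T \<longleftrightarrow> (\<exists>\<phi>\<in>L2 \<nu>. \<not> (AE y in \<nu>. \<phi> y = 0) \<and>
        Y.mdiam (Y.L2_supp \<nu> \<phi>) \<le> of_nat F \<and>
        sqrt c * c' * L2_opnorm \<nu> T * L2_norm \<nu> \<phi> \<le> L2_norm \<nu> (T \<phi>))"
      for F :: nat and \<nu> :: "'g measure" and T :: "('g \<Rightarrow> 'h) \<Rightarrow> 'g \<Rightarrow> 'h"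
    have "\<exists>F. \<forall>k \<nu> T. Y.positive_borel_measure \<nu> \<longrightarrow> Y.locally_finite \<nu> \<longrightarrow>
        T \<in> Y.propagation_operators (real k) \<nu> \<longrightarrow> 0 < L2_opnorm \<nu> T \<longrightarrow> good (F k) \<nu> T"
      unfolding good_def
      by (intro choice allI localize_operator[OF assms(11,9) c assms(12) onl])
    then obtain F where F: "\<And>k \<nu> T. Y.positive_borel_measure \<nu> \<Longrightarrow> Y.locally_finite \<nu> \<Longrightarrow>
        T \<in> Y.propagation_operators (real k) \<nu> \<Longrightarrow> 0 < L2_opnorm \<nu> T \<Longrightarrow> good (F k) \<nu> T"
      by blast
    \<comment> \<open>Partial sums give a non-decreasing function that dominates
      \<open>F\<close>.\<close>
    define f where "f k = (\<Sum>j\<le>k. F j)" for k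
    have "mono f" unfolding f_def by (intro monoI sum_mono2) auto
    moreover have "good (f k) \<nu> T" if \<nu>: "Y.positive_borel_measure \<nu>" "Y.locally_finite \<nu>"
      and T: "T \<in> Y.propagation_operators (real k) \<nu>" for k \<nu> T
    proof (cases "0 < L2_opnorm \<nu> T")
      case True
      have "F k \<le> f k" unfolding f_def by (rule member_le_sum) auto
      then have "(of_nat (F k) :: ennreal) \<le> of_nat (f k)" by simp
      then show ?thesis using F[OF \<nu> T True] unfolding good_def by (meson order_trans)
    next
      \<comment> \<open>At norm zero the inequality is trivial, but a nonzero function of small
        support must still be produced: a nonzero vector placed at an atom.\<close>
      case False
      have "L2_bounded_operator \<nu> T" using T by (simp add: Y.propagation_operators_def)
      then have zero: "L2_opnorm \<nu> T = 0" using False L2_opnorm_nonneg[of \<nu> T] by simp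
      obtain v :: 'h where v: "v \<noteq> 0"
        using assms(8) unfolding infinite_dimensional_def by (metis finite.emptyI sum.empty)
      obtain y where y: "y \<in> carrier G" "emeasure \<nu> {y} \<noteq> 0"
        using Y.ex_atom[OF \<nu>(1) countable_carrier] .
      have s\<nu>: "space \<nu> = carrier G" "sets \<nu> = Pow (carrier G)"
        using \<nu>(1) Y.positive_borel_measure_iff by auto
      \<comment> \<open>A singleton is bounded, so local finiteness makes the atom finite and the
        function at it square integrable.\<close>
      have fin: "emeasure \<nu> {y} < \<infinity>"
        using \<nu>(2) y(1) s\<nu> unfolding Y.locally_finite_def by (simp add: Y.mbounded_insert Y.mbounded_empty)
      define \<phi> where "\<phi> z = (if z = y then v else 0)" for z
      have "(\<lambda>z. (norm (\<phi> z))\<^sup>2) = (\<lambda>z. indicator {y} z *\<^sub>R (norm v)\<^sup>2)"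
        by (auto simp: \<phi>_def fun_eq_iff)
      then have "integrable \<nu> (\<lambda>z. (norm (\<phi> z))\<^sup>2)"
        using fin y(1) s\<nu> by (simp add: integrable_indicator_iff)
      then have "\<phi> \<in> L2 \<nu>"
        using s\<nu> by (simp add: L2_def borel_measurable_Pow)
      moreover have "\<not> (AE z in \<nu>. \<phi> z = 0)"
      proof -
        have "{z \<in> space \<nu>. \<phi> z \<noteq> 0} = {y}" using y(1) v s\<nu> by (auto simp: \<phi>_def)
        then show ?thesis using y s\<nu> AE_iff_measurable[of "{y}" \<nu> "\<lambda>z. \<phi> z = 0"] by simp
      qed
      moreover have supp: "Y.L2_supp \<nu> \<phi> \<subseteq> {y}"
        by (rule Y.L2_supp_subset[OF s\<nu>]) (simp add: \<phi>_def)
      have "word_metric G S a b \<le> real (f k)" if "a \<in> Y.L2_supp \<nu> \<phi>" "b \<in> Y.L2_supp \<nu> \<phi>" for a b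
        using supp that y(1) by (auto dest!: subsetD[OF supp])
      then have "Y.mdiam (Y.L2_supp \<nu> \<phi>) \<le> ennreal (real (f k))"
        by (subst Y.mdiam_le_iff) auto
      ultimately show ?thesis
        unfolding good_def by (intro bexI[of _ \<phi>]) (simp_all add: zero ennreal_of_nat_eq_real_of_nat)
    qed
    moreover have "0 < sqrt c * c'" "sqrt c * c' \<le> 1"
      using assms(9,10,12,13) by (auto intro: mult_le_one)
    ultimately show ?thesis
      unfolding Y.operator_norm_localization_def good_def by blast
  qed
qed

end
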